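(* If $n\geq 9$, then $R(S_n(5),W_8)=2n-1$.
   Context: All graphs are finite and simple. For graphs $G,H$, $R(G,H)$ is the smallest $N$ such that every graph $F$ of order $N$ either contains $G$ as a subgraph or has complement $\overline{F}$ containing $H$. $W_8$ is the wheel of order 9 (a hub joined to every vertex of a cycle $C_8$). $S_k$ is the star of order $k$. $S_n(5)$ is the tree of order $n$ obtained by adding an edge joining the centers of the stars $S_5$ and $S_{n-5}$. *)

theory Defs
  imports Main
begin

type_synonym 'a graph = "'a set \<times> 'a set set"

abbreviation verts :: "'a graph \<Rightarrow> 'a set" where
  "verts G \<equiv> fst G"

abbreviation edges :: "'a graph \<Rightarrow> 'a set set" where
  "edges G \<equiv> snd G"

definition all_edges :: "'a set \<Rightarrow> 'a set set" where
  "all_edges V = {e. e \<subseteq> V \<and> card e = 2}"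

definition simple_graph :: "'a graph \<Rightarrow> bool" where
  "simple_graph G \<longleftrightarrow> finite (verts G) \<and> edges G \<subseteq> all_edges (verts G)"

definition graph_order :: "'a graph \<Rightarrow> nat" where
  "graph_order G = card (verts G)"

definition complement :: "'a graph \<Rightarrow> 'a graph" where
  "complement G = (verts G, all_edges (verts G) - edges G)"

text \<open>\<open>contains_graph F G\<close>: some (not necessarily induced) subgraph of \<open>F\<close> is isomorphic to \<open>G\<close>.\<close>

definition contains_graph :: "'a graph \<Rightarrow> 'b graph \<Rightarrow> bool" where
  "contains_graph F G \<longleftrightarrow>
     (\<exists>f. inj_on f (verts G) \<and> f ` verts G \<subseteq> verts F \<and> (\<forall>e\<in>edges G. f ` e \<in> edges F))"

text \<open>It is enough to let \<open>F\<close> range over graphs whose vertices are natural numbers, since every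
  finite graph is isomorphic to such a graph.\<close>

definition ramsey_number :: "'a graph \<Rightarrow> 'b graph \<Rightarrow> nat" where
  "ramsey_number G H =
     (LEAST N. \<forall>F :: nat graph. simple_graph F \<and> graph_order F = N \<longrightarrow>
        contains_graph F G \<or> contains_graph (complement F) H)"

text \<open>The star of order \<open>k\<close> (not with \<open>k\<close> leaves); its centre is \<open>0\<close>.\<close>

definition star :: "nat \<Rightarrow> nat graph" where
  "star k = ({..<k}, {{0, i} | i. 0 < i \<and> i < k})"

text \<open>A cycle only for \<open>m \<ge> 3\<close>.\<close>

definition cycle :: "nat \<Rightarrow> nat graph" where
  "cycle m = ({..<m}, {{i, (i + 1) mod m} | i. i < m})"

text \<open>The wheel of order \<open>m + 1\<close>; its hub is the additional vertex \<open>m\<close>.\<close>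

definition wheel :: "nat \<Rightarrow> nat graph" where
  "wheel m = (insert m (verts (cycle m)), edges (cycle m) \<union> {{m, i} | i. i \<in> verts (cycle m)})"

text \<open>\<open>double_star n l\<close> is the tree \<open>S\<^sub>n(l)\<close>: the disjoint union of the stars of
  orders \<open>l\<close> and \<open>n - l\<close> together with an edge joining their centres, for \<open>0 < l < n\<close>.\<close>

definition double_star :: "nat \<Rightarrow> nat \<Rightarrow> (nat + nat) graph" where
  "double_star n l =
     (Inl ` verts (star l) \<union> Inr ` verts (star (n - l)),
      (`) Inl ` edges (star l) \<union> (`) Inr ` edges (star (n - l)) \<union> {{Inl 0, Inr 0}})"

lemma simple_graph_star: "simple_graph (star k)"
  by (auto simp: simple_graph_def star_def all_edges_def)

lemma simple_graph_cycle:
  assumes "m \<ge> 3"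
  shows "simple_graph (cycle m)"
proof -
  have "i \<noteq> (i + 1) mod m" if "i < m" for i
    using that assms by (cases "i + 1 = m") auto
  then show ?thesis
    using assms by (auto simp: simple_graph_def cycle_def all_edges_def card_2_iff)
qed

lemma simple_graph_wheel:
  assumes "m \<ge> 3"
  shows "simple_graph (wheel m)"
  using simple_graph_cycle[OF assms]
  by (auto simp: simple_graph_def wheel_def all_edges_def cycle_def card_2_iff)

lemma simple_graph_double_star:
  assumes "0 < l" "l < n"
  shows "simple_graph (double_star n l)"
  using assms
  by (auto simp: simple_graph_def double_star_def star_def all_edges_def card_2_iff)

lemma graph_order_star: "graph_order (star k) = k"
  by (simp add: graph_order_def star_def)

lemma graph_order_wheel: "graph_order (wheel m) = m + 1"
  by (simp add: graph_order_def wheel_def cycle_def)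

lemma graph_order_double_star:
  assumes "l \<le> n"
  shows "graph_order (double_star n l) = n"
proof -
  have "card (Inl ` {..<l} \<union> Inr ` {..<n - l} :: (nat + nat) set)
      = card (Inl ` {..<l} :: (nat + nat) set) + card (Inr ` {..<n - l} :: (nat + nat) set)"
    by (rule card_Un_disjoint) auto
  then show ?thesis
    using assms by (simp add: graph_order_def double_star_def star_def card_image)
qed

end

theory Submission
  imports Defs
begin

text \<open>
  Two disjoint cliques of order \<open>n - 1\<close> give the lower bound. For the upper bound suppose that \<open>F\<close> has
  order \<open>2n - 1\<close> and contains no \<open>S\<^sub>n(5)\<close>, and that no neighbourhood in the complement \<open>H\<close> of \<open>F\<close>
  contains an 8-cycle.

  Some \<open>v\<close> has \<open>F\<close>-degree at least \<open>n - 5\<close>: otherwise \<open>H\<close> has minimum degree \<open>n + 4\<close>, and 8-cycles are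
  found either inside \<open>n + 4\<close> vertices \<open>A\<close> of an \<open>H\<close>-neighbourhood or, around a hub \<open>a \<in> A\<close> with few
  \<open>H\<close>-neighbours in \<open>A\<close>, between \<open>A\<close> and its complement.

  Now let \<open>v\<close> have maximum \<open>F\<close>-degree, with \<open>F\<close>-neighbours \<open>N\<close> and \<open>H\<close>-neighbours \<open>B\<close>. Since \<open>S\<^sub>n(5)\<close> cannot be
  placed on an edge \<open>va\<close> of \<open>F\<close>, every \<open>a \<in> N\<close> sends at most three \<open>F\<close>-edges to \<open>B\<close>, or even has
  \<open>F\<close>-degree at most four. So \<open>H\<close> is almost complete between \<open>N\<close> and \<open>B\<close>, and a vertex of \<open>B\<close> with four
  \<open>H\<close>-neighbours in \<open>B\<close> is typically the hub of a wheel. What is left is a set of \<open>n\<close> vertices of \<open>B\<close> on which \<open>H\<close>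
  has maximum degree three. By the Moore bound it contains two vertices at \<open>H\<close>-distance at least three, or
  it is the Petersen graph, which has an 8-cycle. Two such vertices are the centres of an \<open>S\<^sub>n(5)\<close>.
\<close>

subsection \<open>Eight-cycles through four prescribed vertices\<close>

lemma card_ge_ex: "finite A \<Longrightarrow> card X < card A \<Longrightarrow> finite X \<Longrightarrow> \<exists>a\<in>A. a \<notin> X"
  by (meson card_mono leD subsetI)

lemma distinct_representatives_greedy:
  assumes "1 \<le> card A" "2 \<le> card B" "3 \<le> card C" "4 \<le> card D"
  shows "\<exists>a\<in>A. \<exists>b\<in>B. \<exists>c\<in>C. \<exists>d\<in>D. distinct [a, b, c, d]"
proof -
  have fin: "finite A" "finite B" "finite C" "finite D"
    using assms by (auto intro: card_ge_0_finite)
  have "A \<noteq> {}" using assms(1) by auto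
  then obtain a where "a \<in> A" by blast
  moreover obtain b where "b \<in> B" "b \<notin> {a}"
    using card_ge_ex[of B "{a}"] fin assms by auto
  moreover have "card {a, b} < card C"
    using assms(3) card_insert_le_m1[of 2 "{b}" a] by simp
  then obtain c where "c \<in> C" "c \<notin> {a, b}"
    using card_ge_ex[of C "{a, b}"] fin by auto
  moreover have "card {a, b, c} < card D"
    using assms(4) by (simp add: card_insert_if)
  then obtain d where "d \<in> D" "d \<notin> {a, b, c}"
    using card_ge_ex[of D "{a, b, c}"] fin by auto
  ultimately show ?thesis by force
qed

lemma distinct_representatives_three:
  assumes "2 \<le> card A" "2 \<le> card B" "2 \<le> card C" "3 \<le> card (A \<union> B \<union> C)"
  shows "\<exists>a\<in>A. \<exists>b\<in>B. \<exists>c\<in>C. distinct [a, b, c]"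
proof -
  have fin: "finite A" "finite B" "finite C"
    using assms by (auto intro: card_ge_0_finite)
  have "A \<noteq> {}" using assms(1) by auto
  then obtain a where a: "a \<in> A" by blast
  obtain b where b: "b \<in> B" "b \<noteq> a"
    using card_ge_ex[of B "{a}"] fin assms by auto
  show ?thesis
  proof (cases "C \<subseteq> {a, b}")
    case True
    \<comment> \<open>\<open>a\<close> and \<open>b\<close> exhaust \<open>C\<close>, so an element
      outside \<open>{a, b}\<close> lies in \<open>A\<close> or \<open>B\<close>. It takes over from
      \<open>a\<close> or \<open>b\<close>, which then represents \<open>C\<close>.\<close>
    with assms(3) b have C: "C = {a, b}"
      by (intro card_seteq) auto
    have "card {a, b} < card (A \<union> B \<union> C)" using assms(4) b by simp
    then obtain z where "z \<in> A \<union> B \<union> C" "z \<notin> {a, b}"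
      using card_ge_ex[of "A \<union> B \<union> C" "{a, b}"] fin by auto
    with C a b show ?thesis by fastforce
  next
    case False
    with a b show ?thesis by fastforce
  qed
qed

text \<open>An augmenting path. If \<open>z\<close> were in \<open>A\<close> or \<open>B\<close>, it
  would release \<open>a\<close> or \<open>b\<close> to \<open>D\<close>; so \<open>z\<close> lies
  in \<open>C\<close> only. It frees \<open>c\<close>, which by the same token is in none of
  \<open>A\<close>, \<open>B\<close>, \<open>D\<close>. Hence \<open>y\<close> is a new element of
  \<open>A\<close> or \<open>B\<close> that releases \<open>a\<close> or \<open>b\<close> to
  \<open>D\<close>, while \<open>z\<close> represents \<open>C\<close>.\<close>

lemma distinct_representatives_four_step:
  assumes abc: "a \<in> A" "b \<in> B" "c \<in> C" "distinct [a, b, c]"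
    and D: "D \<subseteq> {a, b, c}" "a \<in> D" "b \<in> D"
    and z: "z \<in> A \<union> B \<union> C" "z \<notin> {a, b, c}"
    and y: "y \<in> A \<union> B \<union> D" "y \<notin> {a, b}"
  shows "\<exists>a\<in>A. \<exists>b\<in>B. \<exists>c\<in>C. \<exists>d\<in>D. distinct [a, b, c, d]"
proof (rule ccontr)
  assume no: "\<not> ?thesis"
  have no': "\<not> distinct [p, q, r, s]" if "p \<in> A" "q \<in> B" "r \<in> C" "s \<in> D" for p q r s
    using no that by blast
  have zC: "z \<in> C" "z \<notin> A" "z \<notin> B"
    using z D abc no'[of z b c a] no'[of a z c b] by auto
  have zN: "z \<noteq> a" "z \<noteq> b" "z \<noteq> c" using z by auto
  have "c \<notin> D" using no'[of a b z c] zC zN abc by auto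
  moreover have "c \<notin> A" using no'[of c b z a] zC zN abc D by auto
  moreover have "c \<notin> B" using no'[of a c z b] zC zN abc D by auto
  ultimately have "y \<noteq> c" using y by blast
  then have "y \<in> A \<or> y \<in> B" "y \<noteq> z" using y D zC by auto
  then show False
    using no'[of y b z a] no'[of a y z b] zN zC abc D y by auto
qed

text \<open>Hall's theorem for four sets with at least two elements each. If representatives of
  \<open>A\<close>, \<open>B\<close>, \<open>C\<close> exhaust \<open>D\<close>, two of them lie in
  \<open>D\<close>; the three possible pairs differ only by a permutation of \<open>A\<close>,
  \<open>B\<close>, \<open>C\<close>.\<close>

lemma distinct_representatives_four:
  assumes "2 \<le> card A" "2 \<le> card B" "2 \<le> card C" "2 \<le> card D"
    and "3 \<le> card (A \<union> B \<union> C)" "3 \<le> card (A \<union> B \<union> D)" "3 \<le> card (A \<union> C \<union> D)" "3 \<le> card (B \<union> C \<union> D)"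
    and "4 \<le> card (A \<union> B \<union> C \<union> D)"
  shows "\<exists>a\<in>A. \<exists>b\<in>B. \<exists>c\<in>C. \<exists>d\<in>D. distinct [a, b, c, d]"
proof -
  have fin: "finite A" "finite B" "finite C" "finite D"
    using assms by (auto intro: card_ge_0_finite)
  obtain a b c where abc: "a \<in> A" "b \<in> B" "c \<in> C" "distinct [a, b, c]"
    using distinct_representatives_three[OF assms(1-3,5)] by blast
  show ?thesis
  proof (cases "D \<subseteq> {a, b, c}")
    case False
    with abc show ?thesis by fastforce
  next
    case D: True
    have "card {a, b, c} < card (A \<union> B \<union> C \<union> D)" using assms(9) abc by simp
    then obtain z where "z \<in> A \<union> B \<union> C \<union> D" "z \<notin> {a, b, c}"
      using card_ge_ex[of "A \<union> B \<union> C \<union> D" "{a, b, c}"] fin by auto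
    then have z: "z \<in> A \<union> B \<union> C" "z \<notin> {a, b, c}" using D by auto
    have ex: "\<exists>y\<in>Z. y \<notin> {p, q}" if "3 \<le> card Z" for Z :: "'a set" and p q
    proof -
      have "card {p, q} < card Z" using that card_insert_le_m1[of 2 "{q}" p] by simp
      with that show ?thesis by (intro card_ge_ex) (auto intro: card_ge_0_finite)
    qed
    have "1 < card D" using assms(4) by simp
    then obtain d d' where "d \<in> D" "d' \<in> D" "d \<noteq> d'"
      by (metis One_nat_def card_1_singleton_iff card_le_Suc0_iff_eq fin(4) leD)
    then consider "a \<in> D" "b \<in> D" | "a \<in> D" "c \<in> D" | "b \<in> D" "c \<in> D" using D by auto
    then show ?thesis
    proof cases
      case 1
      obtain y where "y \<in> A \<union> B \<union> D" "y \<notin> {a, b}" using ex[OF assms(6)] by blast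
      with distinct_representatives_four_step[OF abc D 1 z] show ?thesis by blast
    next
      case 2
      obtain y where "y \<in> A \<union> C \<union> D" "y \<notin> {a, c}" using ex[OF assms(7)] by blast
      with distinct_representatives_four_step[of a A c C b B D z y] 2 abc D z show ?thesis by force
    next
      case 3
      obtain y where "y \<in> B \<union> C \<union> D" "y \<notin> {b, c}" using ex[OF assms(8)] by blast
      with distinct_representatives_four_step[of b B c C a A D z y] 3 abc D z show ?thesis by force
    qed
  qed
qed

section \<open>Eight-cycles alternating between four vertices and a set\<close>

definition has_C8 :: "('a \<Rightarrow> 'a \<Rightarrow> bool) \<Rightarrow> 'a set \<Rightarrow> bool" where
  "has_C8 H S \<longleftrightarrow> (\<exists>xs. length xs = 8 \<and> distinct xs \<and> set xs \<subseteq> S \<and>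
     (\<forall>i<8. H (xs ! i) (xs ! ((i + 1) mod 8))))"

lemma has_C8I:
  assumes "distinct [a, b, c, d, e, f, g, h]" "{a, b, c, d, e, f, g, h} \<subseteq> S"
    and "H a b" "H b c" "H c d" "H d e" "H e f" "H f g" "H g h" "H h a"
  shows "has_C8 H S"
  unfolding has_C8_def
proof (intro exI[of _ "[a, b, c, d, e, f, g, h]"] conjI allI impI)
  fix i :: nat assume "i < 8"
  then have "i \<in> {0, 1, 2, 3, 4, 5, 6, 7}" by auto
  then show "H ([a, b, c, d, e, f, g, h] ! i) ([a, b, c, d, e, f, g, h] ! ((i + 1) mod 8))"
    using assms(3-) by auto
qed (use assms in auto)

lemma has_C8_mono: "has_C8 H S \<Longrightarrow> S \<subseteq> T \<Longrightarrow> has_C8 H T"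
  unfolding has_C8_def by (meson order_trans)

locale sym_rel =
  fixes H :: "'a \<Rightarrow> 'a \<Rightarrow> bool"
  assumes sym: "H x y \<Longrightarrow> H y x"
begin

definition nb :: "'a set \<Rightarrow> 'a \<Rightarrow> 'a set" where
  "nb Y x = {y \<in> Y. H x y}"

lemma nb_subset: "nb Y x \<subseteq> Y" and finite_nb: "finite Y \<Longrightarrow> finite (nb Y x)"
  by (auto simp: nb_def)

lemma C8_alternating:
  assumes "distinct [x1, x2, x3, x4]" "{x1, x2, x3, x4} \<subseteq> S" "Y \<subseteq> S" "Y \<inter> {x1, x2, x3, x4} = {}"
    and "\<exists>y1 \<in> nb Y x1 \<inter> nb Y x2. \<exists>y2 \<in> nb Y x2 \<inter> nb Y x3. \<exists>y3 \<in> nb Y x3 \<inter> nb Y x4.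
      \<exists>y4 \<in> nb Y x4 \<inter> nb Y x1. distinct [y1, y2, y3, y4]"
  shows "has_C8 H S"
proof -
  obtain y1 y2 y3 y4 where y: "y1 \<in> nb Y x1 \<inter> nb Y x2" "y2 \<in> nb Y x2 \<inter> nb Y x3"
    "y3 \<in> nb Y x3 \<inter> nb Y x4" "y4 \<in> nb Y x4 \<inter> nb Y x1" "distinct [y1, y2, y3, y4]"
    using assms(5) by blast
  show ?thesis
    by (rule has_C8I[of x1 y1 x2 y2 x3 y3 x4 y4])
       (use assms(1-4) y sym in \<open>auto simp: nb_def\<close>)
qed

lemma card_Int_ge:
  assumes "finite Y" "A \<subseteq> Y" "B \<subseteq> Y"
  shows "card A + card B \<le> card Y + card (A \<inter> B)"
proof -
  have "finite A" "finite B" using assms finite_subset by auto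
  then have "card A + card B = card (A \<union> B) + card (A \<inter> B)" by (rule card_Un_Int)
  moreover have "card (A \<union> B) \<le> card Y" using assms by (intro card_mono) auto
  ultimately show ?thesis by simp
qed

text \<open>The case of four vertices on one side of Jackson's theorem on cycles in bipartite graphs.
  If the common neighbourhoods along the cyclic order \<open>x1, x2, x3, x4\<close> have no system of distinct
  representatives, then \<open>x1, x3\<close> and \<open>x2, x4\<close> have almost the same neighbours, and another
  cyclic order works.\<close>
lemma C8_Jackson:
  assumes x: "distinct [x1, x2, x3, x4]" "{x1, x2, x3, x4} \<subseteq> S"
    and Y: "finite Y" "Y \<subseteq> S" "Y \<inter> {x1, x2, x3, x4} = {}" "6 \<le> card Y"
    and deg: "\<And>x. x \<in> {x1, x2, x3, x4} \<Longrightarrow> card Y + 2 \<le> 2 * card (nb Y x)"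
  shows "has_C8 H S"
proof (rule ccontr)
  assume no: "\<not> has_C8 H S"
  let ?q = "card Y" and ?N1 = "nb Y x1" and ?N2 = "nb Y x2" and ?N3 = "nb Y x3" and ?N4 = "nb Y x4"
  have fin: "finite (nb Y x)" for x using Y(1) by (rule finite_nb)
  note deg' = deg[of x1, simplified] deg[of x2, simplified] deg[of x3, simplified] deg[of x4, simplified]
  have two: "2 \<le> card (nb Y x \<inter> nb Y y)" if "x \<in> {x1, x2, x3, x4}" "y \<in> {x1, x2, x3, x4}" for x y
    using card_Int_ge[OF Y(1) nb_subset nb_subset, of x y] deg[OF that(1)] deg[OF that(2)] by linarith
  have alt: "\<not> distinct [y1, y2, y3, y4]"
    if "distinct [u1, u2, u3, u4]" "{u1, u2, u3, u4} = {x1, x2, x3, x4}"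
      and "y1 \<in> nb Y u1 \<inter> nb Y u2" "y2 \<in> nb Y u2 \<inter> nb Y u3" "y3 \<in> nb Y u3 \<inter> nb Y u4" "y4 \<in> nb Y u4 \<inter> nb Y u1"
    for u1 u2 u3 u4 y1 y2 y3 y4
    using C8_alternating[OF that(1), of S Y] that(3-) no x(2) Y(2,3) unfolding that(2) by blast
  \<comment> \<open>All common neighbourhoods have at least two elements. So the greedy choice
    succeeds, in any cyclic order, once one of them has four elements and another has three;
    \<open>adj\<close> and \<open>opp\<close> treat consecutive and opposite positions of these
    two.\<close>
  have adj: False if u: "distinct [u1, u2, u3, u4]" "{u1, u2, u3, u4} = {x1, x2, x3, x4}"
    and c: "4 \<le> card (nb Y u1 \<inter> nb Y u2)" "3 \<le> card (nb Y u2 \<inter> nb Y u3)" for u1 u2 u3 u4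
  proof -
    have "1 \<le> card (nb Y u3 \<inter> nb Y u4)" "2 \<le> card (nb Y u4 \<inter> nb Y u1)"
      using two[of u3 u4] two[of u4 u1] unfolding u(2)[symmetric] by simp_all
    from distinct_representatives_greedy[OF this c(2,1)] obtain p q r s where
      "p \<in> nb Y u3 \<inter> nb Y u4" "q \<in> nb Y u4 \<inter> nb Y u1" "r \<in> nb Y u2 \<inter> nb Y u3" "s \<in> nb Y u1 \<inter> nb Y u2"
      "distinct [p, q, r, s]" by blast
    with alt[OF u, of s r p q] show False by auto
  qed
  have opp: False if u: "distinct [u1, u2, u3, u4]" "{u1, u2, u3, u4} = {x1, x2, x3, x4}"
    and c: "4 \<le> card (nb Y u1 \<inter> nb Y u2)" "3 \<le> card (nb Y u3 \<inter> nb Y u4)" for u1 u2 u3 u4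
  proof -
    have "1 \<le> card (nb Y u2 \<inter> nb Y u3)" "2 \<le> card (nb Y u4 \<inter> nb Y u1)"
      using two[of u2 u3] two[of u4 u1] unfolding u(2)[symmetric] by simp_all
    from distinct_representatives_greedy[OF this c(2,1)] obtain p q r s where
      "p \<in> nb Y u2 \<inter> nb Y u3" "q \<in> nb Y u4 \<inter> nb Y u1" "r \<in> nb Y u3 \<inter> nb Y u4" "s \<in> nb Y u1 \<inter> nb Y u2"
      "distinct [p, q, r, s]" by blast
    with alt[OF u, of s p r q] show False by auto
  qed
  define U where "U = (?N1 \<union> ?N3) \<inter> (?N2 \<union> ?N4)"
  have U: "U = (?N1 \<inter> ?N2) \<union> (?N2 \<inter> ?N3) \<union> (?N3 \<inter> ?N4) \<union> (?N4 \<inter> ?N1)" by (auto simp: U_def)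
  \<comment> \<open>Both common neighbourhoods must equal \<open>?W\<close>, and being so small they
    force \<open>u1\<close>, \<open>u2\<close> and likewise \<open>u3\<close>, \<open>u2\<close> to
    cover \<open>Y\<close>. So \<open>u1\<close> and \<open>u3\<close> both see exactly
    \<open>?W\<close> and what \<open>u2\<close> misses.\<close>
  have same: "nb Y u1 = nb Y u3"
    if "u1 \<in> {x1, x2, x3, x4}" "u2 \<in> {x1, x2, x3, x4}" "u3 \<in> {x1, x2, x3, x4}"
      and c: "card ((nb Y u1 \<inter> nb Y u2) \<union> (nb Y u2 \<inter> nb Y u3)) \<le> 2" for u1 u2 u3
  proof -
    let ?W = "(nb Y u1 \<inter> nb Y u2) \<union> (nb Y u2 \<inter> nb Y u3)"
    have 1: "nb Y u1 \<inter> nb Y u2 = ?W" "nb Y u2 \<inter> nb Y u3 = ?W"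
      using two[of u1 u2] two[of u2 u3] that fin by (intro card_seteq; force)+
    have cov: "nb Y u \<union> nb Y u2 = Y" if "card (nb Y u \<inter> nb Y u2) \<le> 2" "u \<in> {x1, x2, x3, x4}" for u
    proof (rule card_seteq)
      show "card Y \<le> card (nb Y u \<union> nb Y u2)"
        using card_Un_Int[OF fin[of u] fin[of u2]] deg[OF that(2)] deg[OF \<open>u2 \<in> _\<close>] that(1) by linarith
    qed (use Y nb_subset in auto)
    have "nb Y u1 \<union> nb Y u2 = Y" "nb Y u3 \<union> nb Y u2 = Y"
      using cov[of u1] cov[of u3] 1 c that(1,3) by (simp_all add: Int_commute)
    with 1 show ?thesis by blast
  qed
  \<comment> \<open>Otherwise Hall's condition holds: if three of the common neighbourhoods had a
    union of at most two elements, \<open>same\<close> would identify the neighbourhoods of two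
    opposite vertices, and that union would be all of \<open>U\<close>.\<close>
  have "card U \<le> 3"
  proof (rule ccontr)
    assume U4: "\<not> card U \<le> 3"
    have tri: "3 \<le> card ((nb Y u1 \<inter> nb Y u2) \<union> (nb Y u2 \<inter> nb Y u3) \<union> Z)"
      if u: "{u1, u2, u3} \<subseteq> {x1, x2, x3, x4}" and Z: "Z \<subseteq> Y"
        and eq: "nb Y u1 = nb Y u3 \<Longrightarrow> U = (nb Y u1 \<inter> nb Y u2) \<union> (nb Y u2 \<inter> nb Y u3) \<union> Z" for u1 u2 u3 Z
    proof (rule ccontr)
      let ?W = "(nb Y u1 \<inter> nb Y u2) \<union> (nb Y u2 \<inter> nb Y u3)"
      assume "\<not> ?thesis"
      then have c: "card (?W \<union> Z) \<le> 2" by simp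
      have "card ?W \<le> card (?W \<union> Z)"
        using fin finite_subset[OF Z Y(1)] by (intro card_mono) auto
      with c have "nb Y u1 = nb Y u3" using u by (intro same[of u1 u2 u3]) auto
      from eq[OF this] c U4 show False by simp
    qed
    have "3 \<le> card ((?N1 \<inter> ?N2) \<union> (?N2 \<inter> ?N3) \<union> (?N3 \<inter> ?N4))"
      "3 \<le> card ((?N1 \<inter> ?N2) \<union> (?N2 \<inter> ?N3) \<union> (?N4 \<inter> ?N1))"
      "3 \<le> card ((?N2 \<inter> ?N3) \<union> (?N3 \<inter> ?N4) \<union> (?N1 \<inter> ?N2))"
      "3 \<le> card ((?N2 \<inter> ?N3) \<union> (?N3 \<inter> ?N4) \<union> (?N4 \<inter> ?N1))"
      "3 \<le> card ((?N3 \<inter> ?N4) \<union> (?N4 \<inter> ?N1) \<union> (?N1 \<inter> ?N2))"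
      by (rule tri; use nb_subset in \<open>auto simp: U\<close>)+
    note tri = this
    have "\<exists>y1 \<in> ?N1 \<inter> ?N2. \<exists>y2 \<in> ?N2 \<inter> ?N3. \<exists>y3 \<in> ?N3 \<inter> ?N4. \<exists>y4 \<in> ?N4 \<inter> ?N1. distinct [y1, y2, y3, y4]"
      by (rule distinct_representatives_four) (use two tri U4 in \<open>simp_all add: U Un_ac\<close>)
    with alt[OF x(1) refl] show False by blast
  qed
  have "card (?N1 \<union> ?N3) + card (?N2 \<union> ?N4) \<le> ?q + card U"
    unfolding U_def using Y(1) nb_subset by (intro card_Int_ge) auto
  \<comment> \<open>The four degrees add up to at least \<open>2 * ?q + 4\<close>, the two unions to
    at most \<open>?q + 3\<close>.\<close>
  with \<open>card U \<le> 3\<close> have sum: "?q + 1 \<le> card (?N1 \<inter> ?N3) + card (?N2 \<inter> ?N4)"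
    using card_Un_Int[OF fin[of x1] fin[of x3]] card_Un_Int[OF fin[of x2] fin[of x4]] deg' by linarith
  \<comment> \<open>This is applied with a formerly opposite pair as \<open>u1\<close>,
    \<open>u2\<close>. If \<open>u3\<close>, \<open>u4\<close> share at most two vertices, then
    \<open>u2\<close> misses at most one vertex of \<open>Y\<close> and so shares at least three
    with \<open>u3\<close>, as \<open>Y\<close> has six or more.\<close>
  have key: False if u: "distinct [u1, u2, u3, u4]" "{u1, u2, u3, u4} = {x1, x2, x3, x4}"
    and c: "4 \<le> card (nb Y u1 \<inter> nb Y u2)" "?q + 1 \<le> card (nb Y u1 \<inter> nb Y u2) + card (nb Y u3 \<inter> nb Y u4)"
    for u1 u2 u3 u4
  proof (cases "3 \<le> card (nb Y u3 \<inter> nb Y u4)")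
    case True
    from opp[OF u c(1) True] show False .
  next
    case False
    have "card (nb Y u1 \<inter> nb Y u2) \<le> card (nb Y u2)" using fin by (intro card_mono) auto
    with False c(2) have "?q \<le> card (nb Y u2) + 1" by linarith
    moreover have "u3 \<in> {x1, x2, x3, x4}" using u(2) by auto
    note deg[OF this]
    moreover note card_Int_ge[OF Y(1) nb_subset nb_subset, of u2 u3] Y(4)
    ultimately have "3 \<le> card (nb Y u2 \<inter> nb Y u3)" by linarith
    from adj[OF u c(1) this] show False .
  qed
  show False
  proof (cases "4 \<le> card (?N1 \<inter> ?N3)")
    case True
    show False by (rule key[of x1 x3 x2 x4]) (use True x sum in auto)
  next
    case False
    show False by (rule key[of x2 x4 x1 x3]) (use False x sum Y(4) in \<open>auto simp: add.commute\<close>)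
  qed
qed

end

subsection \<open>Graphs without eight-cycles\<close>

lemma ex_four:
  assumes "4 \<le> card A"
  obtains a b c d where "a \<in> A" "b \<in> A" "c \<in> A" "d \<in> A" "distinct [a, b, c, d]"
  using distinct_representatives_greedy[of A A A A] assms by fastforce

lemma ex_three:
  assumes "3 \<le> card A"
  obtains a b c where "a \<in> A" "b \<in> A" "c \<in> A" "distinct [a, b, c]"
  using distinct_representatives_three[of A A A] assms by fastforce

lemma ex_two:
  assumes "2 \<le> card A"
  obtains a b where "a \<in> A" "b \<in> A" "a \<noteq> b"
proof -
  have "finite A" "\<not> card A \<le> Suc 0" using assms by (auto intro: card_ge_0_finite)
  then show thesis using that card_le_Suc0_iff_eq[of A] by blast
qed

lemma card_split:
  assumes "finite S"
  shows "card {x \<in> S. P x} + card {x \<in> S. \<not> P x} = card S"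
proof -
  have "card ({x \<in> S. P x} \<union> {x \<in> S. \<not> P x}) = card {x \<in> S. P x} + card {x \<in> S. \<not> P x}"
    by (rule card_Un_disjoint) (use assms in auto)
  moreover have "{x \<in> S. P x} \<union> {x \<in> S. \<not> P x} = S" by auto
  ultimately show ?thesis by simp
qed

lemma card_Un3_ge:
  assumes "finite X" "finite Y" "finite Z"
  shows "card X + card Y + card Z
    \<le> card (X \<union> Y \<union> Z) + card (X \<inter> Y) + card (Y \<inter> Z) + card (X \<inter> Z)"
proof -
  have "card X + card Y = card (X \<union> Y) + card (X \<inter> Y)" using assms by (intro card_Un_Int)
  moreover have "card (X \<union> Y) + card Z = card (X \<union> Y \<union> Z) + card ((X \<union> Y) \<inter> Z)"
    using assms by (intro card_Un_Int) auto
  moreover have "card ((X \<union> Y) \<inter> Z) \<le> card (X \<inter> Z) + card (Y \<inter> Z)"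
    by (metis Int_Un_distrib2 card_Un_le)
  ultimately show ?thesis by linarith
qed

text \<open>The non-neighbours of a vertex are pairwise related, so four of them give a 4-cycle.
  With at most three, \<open>p\<close> has at least seven neighbours, and a neighbour
  \<open>q\<close> of \<open>p\<close> is related to three of the others; two of these close a cycle
  with \<open>p\<close> and \<open>q\<close>.\<close>

lemma C4_if_no_independent_triple:
  assumes sym: "\<And>x y. R x y \<Longrightarrow> R y x" and card: "11 \<le> card P"
    and triple: "\<And>x y z. x \<in> P \<Longrightarrow> y \<in> P \<Longrightarrow> z \<in> P \<Longrightarrow> distinct [x, y, z] \<Longrightarrow> R x y \<or> R y z \<or> R x z"
  obtains a b c d where "{a, b, c, d} \<subseteq> P" "distinct [a, b, c, d]" "R a b" "R b c" "R c d" "R d a"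
proof -
  note result = that
  have fin: "finite P" using card by (auto intro: card_ge_0_finite)
  have nonadj: thesis if Q: "Q \<subseteq> P" "p \<in> P" "p \<notin> Q" "\<forall>q\<in>Q. \<not> R p q" "4 \<le> card Q" for p Q
  proof -
    obtain a b c d where q: "a \<in> Q" "b \<in> Q" "c \<in> Q" "d \<in> Q" "distinct [a, b, c, d]"
      using ex_four[OF Q(5)] by blast
    have "R x y" if "x \<in> Q" "y \<in> Q" "x \<noteq> y" for x y
      using triple[of p x y] that Q by auto
    then have "R a b" "R b c" "R c d" "R d a" using q by auto
    with result[of a b c d] q Q(1) show thesis by blast
  qed
  have "P \<noteq> {}" using card by auto
  then obtain p where p: "p \<in> P" by blast
  define M N where "M = {q \<in> P - {p}. R p q}" and "N = {q \<in> P - {p}. \<not> R p q}"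
  have "card M + card N = card (P - {p})"
    unfolding M_def N_def using fin by (intro card_split) simp
  then have MN: "10 \<le> card M + card N" using card p fin by simp
  show thesis
  proof (cases "4 \<le> card N")
    case True
    show thesis by (rule nonadj[OF _ _ _ _ True, of p]) (use p in \<open>auto simp: N_def\<close>)
  next
    case False
    then have M: "7 \<le> card M" using MN by simp
    then have "M \<noteq> {}" by auto
    then obtain q where q: "q \<in> M" by blast
    define M1 M2 where "M1 = {r \<in> M - {q}. R q r}" and "M2 = {r \<in> M - {q}. \<not> R q r}"
    have finM: "finite M" using fin by (simp add: M_def)
    have "card M1 + card M2 = card (M - {q})"
      unfolding M1_def M2_def using finM by (intro card_split) simp
    then have MM: "6 \<le> card M1 + card M2" using M q finM by simp
    show thesis
    proof (cases "4 \<le> card M2")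
      case True
      show thesis by (rule nonadj[OF _ _ _ _ True, of q]) (use q in \<open>auto simp: M_def M2_def\<close>)
    next
      case False
      with MM have 2: "3 \<le> card M1" by simp
      obtain r s t where "r \<in> M1" "s \<in> M1" "t \<in> M1" "distinct [r, s, t]" using ex_three[OF 2] by blast
      then have rs: "r \<in> P" "s \<in> P" "distinct [p, r, q, s]" "R p r" "R q r" "R q s" "R p s"
        using q by (auto simp: M_def M1_def)
      moreover have "R r q" "R s p" using rs sym by blast+
      ultimately show thesis using result[of p r q s] p q by (simp add: M_def)
    qed
  qed
qed

locale graph_rel = sym_rel +
  assumes irrefl: "\<not> H x x"
begin

lemma comm: "H x y \<longleftrightarrow> H y x"
  using sym by blast

text \<open>When \<open>H\<close> is the complement of a graph \<open>F\<close>, this is the set of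
  \<open>F\<close>-neighbours of \<open>x\<close> in \<open>Y\<close>.\<close>

definition non_nb :: "'a set \<Rightarrow> 'a \<Rightarrow> 'a set" where
  "non_nb Y x = {y \<in> Y. y \<noteq> x \<and> \<not> H x y}"

lemma finite_non_nb: "finite Y \<Longrightarrow> finite (non_nb Y x)"
  by (simp add: non_nb_def)

lemma non_nb_mono: "Y \<subseteq> Z \<Longrightarrow> finite Z \<Longrightarrow> card (non_nb Y x) \<le> card (non_nb Z x)"
  by (intro card_mono) (auto simp: non_nb_def)

lemma card_nb_non_nb: "finite Y \<Longrightarrow> card (nb Y x) + card (non_nb Y x) = card (Y - {x})"
  using card_split[of "Y - {x}" "H x"] irrefl
  by (simp add: nb_def non_nb_def) (smt (verit) Collect_cong)

lemma card_nb_non_nb_notin: "finite Y \<Longrightarrow> x \<notin> Y \<Longrightarrow> card (nb Y x) + card (non_nb Y x) = card Y"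
  using card_nb_non_nb by fastforce

lemma card_nb_non_nb_in: "finite Y \<Longrightarrow> x \<in> Y \<Longrightarrow> card (nb Y x) + card (non_nb Y x) + 1 = card Y"
  using card_nb_non_nb[of Y x] card_Suc_Diff1[of Y x] by simp

lemma C8_Jackson_non_nb:
  assumes "X \<subseteq> S" "4 \<le> card X" "finite Y" "Y \<subseteq> S" "Y \<inter> X = {}" "6 \<le> card Y"
    and non: "\<And>x. x \<in> X \<Longrightarrow> 2 * card (non_nb Y x) + 2 \<le> card Y"
  shows "has_C8 H S"
proof -
  obtain a b c d where q: "a \<in> X" "b \<in> X" "c \<in> X" "d \<in> X" "distinct [a, b, c, d]"
    using ex_four[OF assms(2)] by blast
  have "card Y + 2 \<le> 2 * card (nb Y x)" if "x \<in> X" for x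
    using card_nb_non_nb_notin[of Y x] non[OF that] assms(3,5) that by force
  then show ?thesis
    by (intro C8_Jackson[of a b c d S Y]) (use assms q in auto)
qed

text \<open>By inclusion-exclusion, among any three vertices of \<open>P\<close> two share at least
  six neighbours, so the relation \<open>R\<close> has a 4-cycle. Removing the other two vertices of
  that cycle leaves each consecutive pair four common neighbours, enough for a greedy
  choice.\<close>

lemma C8_common_neighbours:
  assumes A: "finite A" "P \<subseteq> A" "11 \<le> card P"
    and triple: "\<And>x y z. x \<in> P \<Longrightarrow> y \<in> P \<Longrightarrow> z \<in> P \<Longrightarrow>
      card A + 16 \<le> card (nb A x) + card (nb A y) + card (nb A z)"
  shows "has_C8 H A"
proof -
  define R where "R x y \<longleftrightarrow> 6 \<le> card (nb A x \<inter> nb A y)" for x y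
  have fin: "finite (nb A x)" for x using A(1) by (rule finite_nb)
  obtain a b c d where abcd: "{a, b, c, d} \<subseteq> P" "distinct [a, b, c, d]" "R a b" "R b c" "R c d" "R d a"
  proof (rule C4_if_no_independent_triple[of R P])
    show "R y x" if "R x y" for x y using that by (simp add: R_def Int_commute)
    show "R x y \<or> R y z \<or> R x z" if "x \<in> P" "y \<in> P" "z \<in> P" for x y z
    proof -
      let ?X = "nb A x" and ?Y = "nb A y" and ?Z = "nb A z"
      have "card (?X \<union> ?Y \<union> ?Z) \<le> card A" using A(1) nb_subset by (intro card_mono) auto
      with card_Un3_ge[OF fin fin fin, of x y z] show ?thesis
        using triple[OF that] unfolding R_def by linarith
    qed
  qed (use A(3) in auto)
  let ?Y = "A - {a, b, c, d}"
  have com: "4 \<le> card (nb ?Y x \<inter> nb ?Y y)"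
    if "R x y" "{a, b, c, d} = {x, y, z, w}" for x y z w
  proof -
    have "nb A x \<inter> nb A y - {z, w} \<subseteq> nb ?Y x \<inter> nb ?Y y"
      unfolding that(2) by (auto simp: nb_def irrefl)
    then have "card (nb A x \<inter> nb A y - {z, w}) \<le> card (nb ?Y x \<inter> nb ?Y y)"
      using A(1) by (intro card_mono) (auto intro: finite_nb)
    moreover have "card (nb A x \<inter> nb A y) - card {z, w} \<le> card (nb A x \<inter> nb A y - {z, w})"
      by (intro diff_card_le_card_Diff) auto
    moreover have "card {z, w} \<le> 2" by (simp add: card_insert_if)
    ultimately show ?thesis using that(1) unfolding R_def by linarith
  qed
  have c: "4 \<le> card (nb ?Y a \<inter> nb ?Y b)" "4 \<le> card (nb ?Y b \<inter> nb ?Y c)"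
    "4 \<le> card (nb ?Y c \<inter> nb ?Y d)" "4 \<le> card (nb ?Y d \<inter> nb ?Y a)"
    by (rule com[of a b c d] com[of b c a d] com[of c d a b] com[of d a b c]; use abcd in blast)+
  have "\<exists>y1 \<in> nb ?Y a \<inter> nb ?Y b. \<exists>y2 \<in> nb ?Y b \<inter> nb ?Y c. \<exists>y3 \<in> nb ?Y c \<inter> nb ?Y d.
    \<exists>y4 \<in> nb ?Y d \<inter> nb ?Y a. distinct [y1, y2, y3, y4]"
    by (rule distinct_representatives_greedy) (use c in linarith)+
  then show ?thesis
    using C8_alternating[OF abcd(2), of A ?Y] abcd(1) A(2) by blast
qed

lemma even_degree_sum: "finite B \<Longrightarrow> even (\<Sum>x\<in>B. card (nb B x))"
proof (induction B rule: finite_induct)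
  case (insert z B)
  have "card (nb (insert z B) x) = card (nb B x) + (if H x z then 1 else 0)" if "x \<in> B" for x
  proof -
    have "nb (insert z B) x = (if H x z then insert z (nb B x) else nb B x)" by (auto simp: nb_def)
    moreover have "z \<notin> nb B x" using insert(2) by (simp add: nb_def)
    ultimately show ?thesis using insert(1) finite_nb by simp
  qed
  then have "(\<Sum>x\<in>B. card (nb (insert z B) x)) = (\<Sum>x\<in>B. card (nb B x)) + (\<Sum>x\<in>B. if H x z then 1 else 0)"
    by (simp add: sum.distrib)
  also have "(\<Sum>x\<in>B. if H x z then 1 else 0) = card (nb B z)"
  proof -
    have "nb B z = {x \<in> B. H x z}" unfolding nb_def using sym by blast
    then show ?thesis using insert(1) by (simp add: sum.If_cases Int_def)
  qed
  finally have "(\<Sum>x\<in>B. card (nb (insert z B) x)) = (\<Sum>x\<in>B. card (nb B x)) + card (nb B z)" .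
  moreover have "nb (insert z B) z = nb B z" using irrefl by (auto simp: nb_def)
  ultimately have "(\<Sum>x\<in>insert z B. card (nb (insert z B) x)) = (\<Sum>x\<in>B. card (nb B x)) + 2 * card (nb B z)"
    using insert by simp
  with insert(3) show ?case by simp
qed simp

text \<open>By the Moore bound a graph with maximum degree at most three and diameter at most two has
  at most ten vertices; equality holds for the Petersen graph only, which has an 8-cycle.\<close>
lemma ex_distance_3:
  assumes B: "finite B" "9 \<le> card B" and deg: "\<And>x. x \<in> B \<Longrightarrow> card (nb B x) \<le> 3"
    and no: "\<not> has_C8 H B"
  shows "\<exists>u\<in>B. \<exists>w\<in>B. u \<noteq> w \<and> \<not> H u w \<and> nb B u \<inter> nb B w = {}"
proof (rule ccontr)
  assume contr: "\<not> ?thesis"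
  have common: "\<exists>z\<in>B. H u z \<and> H z w" if "u \<in> B" "w \<in> B" "u \<noteq> w" "\<not> H u w" for u w
  proof -
    have "nb B u \<inter> nb B w \<noteq> {}" using contr that by blast
    then obtain z where "z \<in> B" "H u z" "H w z" by (auto simp: nb_def)
    with sym[of w z] show ?thesis by blast
  qed
  have fin: "finite (nb B x)" for x using B(1) by (rule finite_nb)
  have cover: "B \<subseteq> {r} \<union> (nb B r \<union> (\<Union>x\<in>nb B r. nb B x - {r}))" if "r \<in> B" for r
  proof
    fix y assume "y \<in> B"
    then show "y \<in> {r} \<union> (nb B r \<union> (\<Union>x\<in>nb B r. nb B x - {r}))"
      using common[OF that \<open>y \<in> B\<close>] by (cases "y = r \<or> H r y") (auto simp: nb_def)
  qed
  have minus1: "card (nb B x - {r}) \<le> 2" if "r \<in> B" "x \<in> nb B r" for x r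
  proof -
    have "r \<in> nb B x" "x \<in> B" using that by (auto simp: nb_def comm)
    with deg[of x] show ?thesis by (simp add: card_Diff_singleton)
  qed
  have bound: "card B \<le> 1 + card (nb B r) + card (\<Union>x\<in>nb B r. nb B x - {r})" if "r \<in> B" for r
  proof -
    have "card B \<le> card ({r} \<union> (nb B r \<union> (\<Union>x\<in>nb B r. nb B x - {r})))"
      using cover[OF that] fin by (intro card_mono) auto
    also have "\<dots> \<le> card {r} + (card (nb B r) + card (\<Union>x\<in>nb B r. nb B x - {r}))"
      by (meson card_Un_le add_left_mono order_trans)
    finally show ?thesis by simp
  qed
  \<comment> \<open>A root of degree at most two reaches at most 1 + 2 + 4 = 7 vertices.\<close>
  have deg3: "card (nb B r) = 3" if "r \<in> B" for r
  proof -
    have "card (\<Union>x\<in>nb B r. nb B x - {r}) \<le> (\<Sum>x\<in>nb B r. card (nb B x - {r}))"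
      by (rule card_UN_le[OF fin])
    also have "\<dots> \<le> (\<Sum>x\<in>nb B r. 2)"
      by (rule sum_mono) (use minus1 that in auto)
    finally show ?thesis using bound[OF that] B(2) deg[OF that] by simp
  qed
  have three: "\<exists>p q. nb B r = {x, p, q} \<and> x \<noteq> p \<and> x \<noteq> q \<and> p \<noteq> q" if "r \<in> B" "x \<in> nb B r" for r x
  proof -
    have "card (nb B r - {x}) = 2" using deg3[OF that(1)] that(2) fin by simp
    then obtain p q where pq: "nb B r - {x} = {p, q}" "p \<noteq> q" by (auto simp: card_2_iff)
    then have "nb B r = {x, p, q}" "x \<noteq> p" "x \<noteq> q" using that(2) by blast+
    with pq(2) show ?thesis by blast
  qed
  have "card B \<noteq> 9"
  proof
    assume "card B = 9"
    with deg3 have "(\<Sum>x\<in>B. card (nb B x)) = 27" by simp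
    with even_degree_sum[OF B(1)] show False by simp
  qed
  with B(2) have B10: "10 \<le> card B" by simp
  \<comment> \<open>Ten vertices attain the Moore bound 1 + 3 + 6. So each neighbour of
    \<open>x\<close> has two further neighbours, disjoint from those of the other neighbours; this
    excludes triangles and 4-cycles.\<close>
  have leaves: "card (nb B y - {x, y, z, w}) = 2 \<and> card ((nb B y \<union> nb B z) - {x, y, z, w}) = 4"
    if x: "x \<in> B" and N: "nb B x = {y, z, w}" for x y z w
  proof -
    let ?U = "\<lambda>u. nb B u - {x, y, z, w}"
    have U2: "card (?U u) \<le> 2" if "u \<in> {y, z, w}" for u
    proof -
      have "card (?U u) \<le> card (nb B u - {x})" using fin by (intro card_mono) auto
      with minus1[OF x, of u] that N show ?thesis by auto
    qed
    have "B \<subseteq> {x, y, z, w} \<union> (?U y \<union> ?U z \<union> ?U w)" using cover[OF x] unfolding N by blast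
    then have "card B \<le> card ({x, y, z, w} \<union> (?U y \<union> ?U z \<union> ?U w))"
      using fin by (intro card_mono) auto
    also have "\<dots> \<le> card {x, y, z, w} + card (?U y \<union> ?U z \<union> ?U w)" by (rule card_Un_le)
    also have "card {x, y, z, w} \<le> 4" by (simp add: card_insert_if)
    also have "card (?U y \<union> ?U z \<union> ?U w) \<le> card (?U y \<union> ?U z) + card (?U w)" by (rule card_Un_le)
    finally have "10 \<le> 4 + (card (?U y \<union> ?U z) + card (?U w))" using B10 by linarith
    moreover have "card (?U y \<union> ?U z) \<le> card (?U y) + card (?U z)" by (rule card_Un_le)
    ultimately have "card (?U y) = 2" "card (?U y \<union> ?U z) = 4"
      using U2[of y] U2[of z] U2[of w] by simp_all
    moreover have "?U y \<union> ?U z = (nb B y \<union> nb B z) - {x, y, z, w}" by blast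
    ultimately show ?thesis by simp
  qed
  have no_triangle: False if xyz: "H x y" "H y z" "H z x" "{x, y, z} \<subseteq> B" for x y z
  proof -
    have "y \<in> nb B x" using that by (auto simp: nb_def)
    then obtain p q where pq: "nb B x = {y, p, q}" using three[of x y] xyz by blast
    moreover have "z \<in> nb B x" "z \<noteq> y" using that irrefl by (auto simp: nb_def comm)
    ultimately obtain w where N: "nb B x = {y, z, w}" by (metis insertE insert_commute singletonD)
    have "nb B y - {x, y, z, w} \<subseteq> nb B y - {x} - {z}" by blast
    then have "card (nb B y - {x, y, z, w}) \<le> card (nb B y - {x} - {z})"
      using fin by (intro card_mono) auto
    also have "\<dots> = card (nb B y) - 1 - 1"
      using fin that irrefl by (subst card_Diff_singleton; auto simp: nb_def comm)+
    also have "\<dots> = 1" using deg3[of y] that by simp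
    finally show False using leaves[OF _ N] that by simp
  qed
  have unique: "y = z" if xyz: "H x y" "H y p" "H x z" "H z p" "p \<noteq> x" "{x, y, z, p} \<subseteq> B" for x y z p
  proof (rule ccontr)
    assume "y \<noteq> z"
    have "y \<in> nb B x" using that by (auto simp: nb_def)
    then obtain p' q where "nb B x = {y, p', q}" using three[of x y] xyz by blast
    moreover have "z \<in> nb B x" using that by (auto simp: nb_def)
    ultimately obtain w where N: "nb B x = {y, z, w}" using \<open>y \<noteq> z\<close> by (metis insertE insert_commute singletonD)
    have "p \<noteq> w" using no_triangle[of x y p] that N by (auto simp: nb_def comm)
    then have p: "p \<in> nb B y - {x, y, z, w}" "p \<in> nb B z - {x, y, z, w}"
      using that irrefl by (auto simp: nb_def)
    have "card (nb B y - {x, y, z, w}) = 2" using leaves[OF _ N] that by simp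
    moreover have "card (nb B z - {x, z, y, w}) = 2" using leaves[of x z y w] N that by (simp add: insert_commute)
    moreover have "{x, z, y, w} = {x, y, z, w}" by blast
    moreover have "card ((nb B y \<union> nb B z) - {x, y, z, w}) = 4" using leaves[OF _ N] that by simp
    moreover have "(nb B y \<union> nb B z) - {x, y, z, w} = (nb B y - {x, y, z, w}) \<union> (nb B z - {x, y, z, w})"
      by blast
    moreover have "card ((nb B y - {x, y, z, w}) \<inter> (nb B z - {x, y, z, w})) > 0"
      using p fin by (auto simp: card_gt_0_iff)
    ultimately show False
      using card_Un_Int[of "nb B y - {x, y, z, w}" "nb B z - {x, y, z, w}"] fin by simp
  qed
  obtain r where r: "r \<in> B" using B by fastforce
  obtain a where a: "a \<in> nb B r" using deg3[OF r] by fastforce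
  obtain b c where abc: "nb B r = {a, b, c}" "distinct [a, b, c]" using three[OF r a] by force
  then have abcB: "a \<in> B" "b \<in> B" "c \<in> B" "H r a" "H r b" "H r c" using nb_subset[of B r] by (auto simp: nb_def)
  \<comment> \<open>A vertex over the neighbour \<open>e\<close> of \<open>r\<close> has, by
    diameter two, a common neighbour with any other neighbour \<open>d\<close> of \<open>r\<close>.
    This permits a walk through vertices over \<open>a\<close>, \<open>b\<close>, \<open>c\<close>,
    \<open>a\<close>, \<open>b\<close> in turn, closed up through \<open>b\<close>,
    \<open>r\<close>, \<open>a\<close>.\<close>
  have leaf: "\<exists>y\<in>B. H x y \<and> H y d \<and> y \<noteq> r \<and> \<not> H r y"
    if x: "x \<in> B" "H x e" "e \<in> {a, b, c}" "d \<in> {a, b, c}" "d \<noteq> e" "x \<noteq> r" for x d e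
  proof -
    have "\<not> H x d" using unique[of r e x d] that abcB r sym by blast
    moreover have "x \<noteq> d" using no_triangle[of r e d] that abcB r sym by blast
    ultimately obtain y where y: "y \<in> B" "H x y" "H y d" using common[of x d] x abcB by blast
    have "y \<noteq> r"
    proof
      assume "y = r"
      then show False using no_triangle[of r e x] y that abcB r sym by blast
    qed
    moreover have "\<not> H r y" using no_triangle[of r y d] y that abcB r sym by blast
    ultimately show ?thesis using y by blast
  qed
  have "card (nb B a - {r}) > 0" using deg3[of a] abcB r fin by (simp add: card_Diff_singleton_if)
  then obtain a1 where a1: "a1 \<in> B" "H a a1" "a1 \<noteq> r"
    using fin by (auto simp: card_gt_0_iff nb_def)
  obtain b1 where b1: "b1 \<in> B" "H a1 b1" "H b1 b" "b1 \<noteq> r" "\<not> H r b1"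
    using leaf[of a1 a b] a1 abc by (auto simp: comm)
  obtain c2 where c2: "c2 \<in> B" "H b1 c2" "H c2 c" "c2 \<noteq> r" "\<not> H r c2"
    using leaf[of b1 b c] b1 abc by (auto simp: comm)
  obtain a2 where a2: "a2 \<in> B" "H c2 a2" "H a2 a" "a2 \<noteq> r" "\<not> H r a2"
    using leaf[of c2 c a] c2 abc by (auto simp: comm)
  obtain b2 where b2: "b2 \<in> B" "H a2 b2" "H b2 b" "b2 \<noteq> r" "\<not> H r b2"
    using leaf[of a2 a b] a2 abc by (auto simp: comm)
  have nHra1: "\<not> H r a1" using no_triangle[of r a a1] a1 abcB r sym by blast
  have own: "e = d" if "H x d" "H x e" "e \<in> {a, b, c}" "d \<in> {a, b, c}" "x \<in> B" "x \<noteq> r" for x d e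
    using unique[of r e x d] that abcB r sym by blast
  have diff: "x \<noteq> y" if "H x d" "H y e" "d \<noteq> e" "e \<in> {a, b, c}" "d \<in> {a, b, c}" "x \<in> B" "x \<noteq> r" for x y d e
    using own[of x d e] that by blast
  have "a1 \<noteq> a2" using no_triangle[of a1 b1 c2] a1 b1 c2 a2 sym by blast
  moreover have "b1 \<noteq> b2" using no_triangle[of b1 c2 a2] b1 c2 a2 b2 sym by blast
  moreover have "a1 \<noteq> b1" "a1 \<noteq> b2" "a2 \<noteq> b1" "a2 \<noteq> b2"
    by (rule diff[where d = a and e = b]; use a1 b1 a2 b2 abc(2) in \<open>auto simp: comm\<close>)+
  moreover have "a1 \<noteq> c2" "a2 \<noteq> c2"
    by (rule diff[where d = a and e = c]; use a1 c2 a2 abc(2) in \<open>auto simp: comm\<close>)+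
  moreover have "b1 \<noteq> c2" "b2 \<noteq> c2"
    by (rule diff[where d = b and e = c]; use b1 b2 c2 abc(2) in \<open>auto simp: comm\<close>)+
  moreover have "r \<noteq> a" "r \<noteq> b" "a \<notin> {a1, b1, c2, a2, b2}" "\<forall>x \<in> {a1, b1, c2, a2, b2}. x \<noteq> b"
    using abcB(4,5) nHra1 b1(5) c2(5) a2(5) b2(5) irrefl by auto
  ultimately have "distinct [r, a, a1, b1, c2, a2, b2, b]"
    using a1(3) b1(4) c2(4) a2(4) b2(4) abc(2) by simp
  then have "has_C8 H B"
  proof (rule has_C8I)
    show "H a1 b1" "H b1 c2" "H c2 a2" "H a2 b2" "H b2 b" "H a a1" "H r a"
      using a1 b1 c2 a2 b2 abcB by simp_all
    show "H b r" using abcB(5) by (rule sym)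
  qed (use a1 b1 c2 a2 b2 abcB r in simp)
  with no show False ..
qed

end

subsection \<open>A vertex of large degree\<close>

context graph_rel
begin

lemma nb_mono: "Y \<subseteq> Z \<Longrightarrow> nb Y x \<subseteq> nb Z x"
  by (auto simp: nb_def)

lemma non_nb_subset: "non_nb Y x \<subseteq> Y"
  by (auto simp: non_nb_def)

lemma mem_nb [simp]: "y \<in> nb Y x \<longleftrightarrow> y \<in> Y \<and> H x y"
  by (auto simp: nb_def)

lemma mem_non_nb [simp]: "y \<in> non_nb Y x \<longleftrightarrow> y \<in> Y \<and> y \<noteq> x \<and> \<not> H x y"
  by (auto simp: non_nb_def)

lemma sum_non_nb_swap:
  assumes "finite P" "finite Q"
  shows "(\<Sum>x\<in>P. card (non_nb Q x)) = (\<Sum>y\<in>Q. card (non_nb P y))"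
proof -
  have card: "card (non_nb S x) = (\<Sum>y\<in>S. if y \<noteq> x \<and> \<not> H x y then 1 else 0)" if "finite S" for S x
    using that by (simp add: non_nb_def sum.If_cases Int_def)
  have "(\<Sum>x\<in>P. card (non_nb Q x)) = (\<Sum>x\<in>P. \<Sum>y\<in>Q. if y \<noteq> x \<and> \<not> H x y then 1 else 0)"
    using card[OF assms(2)] by simp
  also have "\<dots> = (\<Sum>y\<in>Q. \<Sum>x\<in>P. if y \<noteq> x \<and> \<not> H x y then 1 else 0)"
    by (rule sum.swap)
  also have "\<dots> = (\<Sum>y\<in>Q. card (non_nb P y))"
    unfolding card[OF assms(1)] by (intro sum.cong refl if_cong) (auto simp: comm)
  finally show ?thesis .
qed

lemma card_non_nb_Un:
  assumes "finite P" "finite Q" "P \<inter> Q = {}"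
  shows "card (non_nb (P \<union> Q) x) = card (non_nb P x) + card (non_nb Q x)"
proof -
  have "non_nb (P \<union> Q) x = non_nb P x \<union> non_nb Q x" by auto
  moreover have "non_nb P x \<inter> non_nb Q x = {}" using assms(3) by auto
  ultimately show ?thesis using assms finite_non_nb by (simp add: card_Un_disjoint)
qed

lemma card_nb_Un:
  assumes "finite P" "finite Q" "P \<inter> Q = {}"
  shows "card (nb (P \<union> Q) x) = card (nb P x) + card (nb Q x)"
proof -
  have "nb (P \<union> Q) x = nb P x \<union> nb Q x" by auto
  moreover have "nb P x \<inter> nb Q x = {}" using assms(3) by auto
  ultimately show ?thesis using assms finite_nb by (simp add: card_Un_disjoint)
qed

end

text \<open>\<open>no_tree\<close> says that the \<open>F\<close>-edge \<open>uv\<close> does not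
  carry an S_n(5) with four leaves at \<open>u\<close> and \<open>n - 6\<close> at \<open>v\<close>.
  Given these degrees, a union of \<open>n\<close> vertices, which contains \<open>u\<close> and
  \<open>v\<close> themselves, would suffice to choose the leaves disjointly.\<close>

locale ramsey_counterexample = graph_rel +
  fixes V :: "'a set" and n :: nat
  assumes finV: "finite V" and cardV: "card V = 2 * n - 1" and n: "9 \<le> n"
    and no_wheel: "h \<in> V \<Longrightarrow> \<not> has_C8 H (nb V h)"
    and no_tree: "\<lbrakk>u \<in> V; v \<in> V; u \<noteq> v; \<not> H u v; n - 6 \<le> card (non_nb V v - {u}); 4 \<le> card (non_nb V u - {v})\<rbrakk>
      \<Longrightarrow> card (non_nb V u \<union> non_nb V v) < n"
begin

lemma no_Jackson:
  assumes "h \<in> V" "X \<subseteq> nb V h" "4 \<le> card X" "Y \<subseteq> nb V h" "Y \<inter> X = {}" "6 \<le> card Y"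
    and "\<And>x. x \<in> X \<Longrightarrow> 2 * card (non_nb Y x) + 2 \<le> card Y"
  shows False
proof -
  have "finite Y" using assms(6) by (auto intro: card_ge_0_finite)
  from C8_Jackson_non_nb[OF assms(2,3) this assms(4-7)] no_wheel[OF assms(1)] show False by blast
qed

lemma ex_large_non_degree: "\<exists>v\<in>V. n - 5 \<le> card (non_nb V v)"
proof (rule ccontr)
  assume "\<not> ?thesis"
  then have small: "card (non_nb V x) + 6 \<le> n" if "x \<in> V" for x using that n by force
  have "V \<noteq> {}" using cardV n by auto
  then obtain v where v: "v \<in> V" by blast
  \<comment> \<open>\<open>F\<close>-degrees are at most \<open>n - 6\<close> and there are
    \<open>2 * n - 2\<close> other vertices.\<close>
  have "n + 4 \<le> card (nb V v)"
    using card_nb_non_nb_in[OF finV v] small[OF v] cardV n by linarith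
  then obtain A where A: "A \<subseteq> nb V v" "card A = n + 4" "finite A"
    by (meson obtain_subset_with_card_n)
  have AV: "A \<subseteq> V" using A(1) nb_subset by blast
  have noA: "\<not> has_C8 H A" using no_wheel[OF v] A(1) has_C8_mono by blast
  define B where "B = V - A"
  have B: "finite B" "A \<inter> B = {}" "V = A \<union> B" using finV AV by (auto simp: B_def)
  have cardB: "card B + 5 = n"
    using card_Diff_subset[OF A(3) AV] A(2) cardV n by (simp add: B_def)
  define d where "d x = card (nb A x)" for x
  have dA: "d x + card (non_nb A x) = n + 3" if "x \<in> A" for x
    using card_nb_non_nb_in[OF A(3) that] A(2) by (simp add: d_def)
  have dB: "card (non_nb B x) + 9 \<le> d x" if "x \<in> A" for x
    using small[of x] card_non_nb_Un[OF A(3) B(1,2), of x] dA[OF that] that AV B(3) by fastforce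
  \<comment> \<open>Jackson's theorem inside \<open>A\<close>: outside the four chosen vertices
    \<open>n\<close> remain, of which \<open>x\<close> misses at most
    \<open>n + 3 - d x\<close>.\<close>
  have J: False if X: "X \<subseteq> A" "4 \<le> card X" "\<And>x. x \<in> X \<Longrightarrow> n + 8 \<le> 2 * d x" for X
  proof -
    obtain X' where X': "X' \<subseteq> X" "card X' = 4" using X(2) by (meson obtain_subset_with_card_n)
    have Y: "card (A - X') = n"
    proof -
      have "X' \<subseteq> A" using X' X(1) by blast
      then show ?thesis using X'(2) A(2,3) finite_subset[of X' A] by (simp add: card_Diff_subset)
    qed
    have "has_C8 H A"
    proof (rule C8_Jackson_non_nb[of X' A "A - X'"])
      fix x assume "x \<in> X'"
      then have "n + 8 \<le> 2 * d x" "x \<in> A" using X X' by auto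
      moreover have "card (non_nb (A - X') x) \<le> card (non_nb A x)"
        using A(3) by (intro non_nb_mono) auto
      ultimately show "2 * card (non_nb (A - X') x) + 2 \<le> card (A - X')"
        using dA[of x] Y by simp
    qed (use X X' A Y n in auto)
    with noA show False ..
  qed
  have "A \<noteq> {}" using A(2) by auto
  then obtain a where a: "a \<in> A" "\<And>x. x \<in> A \<Longrightarrow> d a \<le> d x"
    using ex_has_least_nat[of "\<lambda>x. x \<in> A" _ d] by blast
  have "2 * d a < n + 8"
  proof (rule ccontr)
    assume "\<not> ?thesis"
    then have "n + 8 \<le> 2 * d x" if "x \<in> A" for x using a(2)[OF that] by simp
    with J[of A] A(2) show False by simp
  qed
  define Y where "Y = nb B a"
  have cardY: "n + 4 \<le> card Y + d a"
  proof -
    have "a \<notin> B" using a(1) B(2) by blast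
    from card_nb_non_nb_notin[OF B(1) this] dB[OF a(1)] cardB show ?thesis unfolding Y_def by linarith
  qed
  have Y6: "6 \<le> card Y"
    using cardY \<open>2 * d a < n + 8\<close> dB[OF a(1)] by linarith
  \<comment> \<open>The inequality is Jackson's condition around the hub \<open>a\<close>:
    \<open>x\<close> misses at most \<open>d x - 9\<close> vertices of \<open>Y\<close>, and
    \<open>Y\<close> has at least \<open>n + 4 - d a\<close>. Hence \<open>G\<close> has at most
    three elements.\<close>
  define G where "G = {x \<in> nb A a. 2 * d x + d a \<le> n + 20}"
  define G' where "G' = {x \<in> nb A a. \<not> 2 * d x + d a \<le> n + 20}"
  have GG: "card G + card G' = d a"
    unfolding G_def G'_def d_def using finite_nb[OF A(3)] by (rule card_split)
  have G: "card G < 4"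
  proof (rule ccontr)
    assume "\<not> ?thesis"
    then have 4: "4 \<le> card G" by simp
    show False
    proof (rule no_Jackson[of a G Y])
      fix x assume x: "x \<in> G"
      then have "x \<in> A" by (simp add: G_def)
      have "card (non_nb Y x) \<le> card (non_nb B x)"
        using B(1) by (intro non_nb_mono) (auto simp: Y_def)
      with dB[OF \<open>x \<in> A\<close>] cardY x show "2 * card (non_nb Y x) + 2 \<le> card Y"
        by (simp add: G_def)
    qed (use a AV B 4 Y6 in \<open>auto simp: G_def Y_def\<close>)
  qed
  have G'd: "n + 21 \<le> 2 * d x + d a" if "x \<in> G'" for x using that by (simp add: G'_def)
  show False
  \<comment> \<open>Up to 13, the inequality defining \<open>G'\<close> yields the hypothesis of
    \<open>J\<close>. From 14 on, \<open>G'\<close> has at least 11 vertices, and minimality of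
    \<open>d a\<close> turns that inequality into \<open>n + 21 \<le> 3 * d x\<close>, enough for
    triples of neighbourhoods.\<close>
  proof (cases "d a \<le> 13")
    case True
    show False
    proof (rule J[of G'])
      show "4 \<le> card G'" using G GG dB[OF a(1)] by linarith
      show "n + 8 \<le> 2 * d x" if "x \<in> G'" for x using G'd[OF that] True by linarith
    qed (auto simp: G'_def)
  next
    case False
    have "has_C8 H A"
    proof (rule C8_common_neighbours[of A G'])
      show "11 \<le> card G'" using G GG False by linarith
      have 3: "n + 21 \<le> 3 * d x" if "x \<in> G'" for x
        using G'd[OF that] a(2)[of x] that by (simp add: G'_def)
      show "card A + 16 \<le> card (nb A x) + card (nb A y) + card (nb A z)"
        if "x \<in> G'" "y \<in> G'" "z \<in> G'" for x y z
        using 3[OF that(1)] 3[OF that(2)] 3[OF that(3)] A(2) unfolding d_def by linarith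
    qed (use A(3) in \<open>auto simp: G'_def\<close>)
    with noA show False ..
  qed
qed

text \<open>Among \<open>n\<close> such vertices two, \<open>u\<close> and \<open>w\<close>, have no
  common \<open>H\<close>-neighbour and are not \<open>H\<close>-adjacent. So each of the
  \<open>n\<close> vertices is an \<open>F\<close>-neighbour of \<open>u\<close> or of
  \<open>w\<close>, and each of these two has at least \<open>n - 4\<close>
  \<open>F\<close>-neighbours there: they are centres of an S_n(5).\<close>

lemma no_sparse_set:
  assumes v: "v \<in> V" and B: "B \<subseteq> nb V v" "n \<le> card B" and deg: "\<And>b. b \<in> B \<Longrightarrow> card (nb B b) \<le> 3"
  shows False
proof -
  obtain C where C: "C \<subseteq> B" "card C = n" "finite C" using B(2) by (meson obtain_subset_with_card_n)
  have CV: "C \<subseteq> V" using C(1) B(1) nb_subset by blast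
  have finB: "finite B" using B(1) finV finite_nb finite_subset by blast
  have deg': "card (nb C x) \<le> 3" if "x \<in> C" for x
  proof -
    have "card (nb C x) \<le> card (nb B x)"
      using C(1) finB by (intro card_mono finite_nb nb_mono)
    with deg[of x] that C(1) show ?thesis by force
  qed
  have "\<not> has_C8 H C" using no_wheel[OF v] has_C8_mono[of H C "nb V v"] C(1) B(1) by blast
  with ex_distance_3[OF C(3) _ deg'] C(2) n obtain u w where
    uw: "u \<in> C" "w \<in> C" "u \<noteq> w" "\<not> H u w" "nb C u \<inter> nb C w = {}" by auto
  have non: "n - 5 \<le> card (non_nb V x - {y})" if "x \<in> C" for x y
  proof -
    have "card (non_nb C x) + 4 \<ge> n"
      using card_nb_non_nb_in[OF C(3) that] deg'[OF that] C(2) by linarith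
    moreover have "card (non_nb C x) \<le> card (non_nb V x)"
      using CV finV by (rule non_nb_mono)
    moreover have "card (non_nb V x) \<le> card (non_nb V x - {y}) + 1"
      by (simp add: card_Diff_singleton_if del: mem_non_nb) linarith
    ultimately show ?thesis by linarith
  qed
  have "card (non_nb V u \<union> non_nb V w) < n"
  proof (rule no_tree)
    show "n - 6 \<le> card (non_nb V w - {u})" using non[OF uw(2), of u] by linarith
    show "4 \<le> card (non_nb V u - {w})" using non[OF uw(1), of w] n by linarith
  qed (use uw CV in auto)
  moreover have "C \<subseteq> non_nb V u \<union> non_nb V w"
  proof
    fix t assume t: "t \<in> C"
    with uw(5) have "\<not> (H u t \<and> H w t)" by auto
    with t uw CV comm[of u w] show "t \<in> non_nb V u \<union> non_nb V w" by auto
  qed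
  then have "card C \<le> card (non_nb V u \<union> non_nb V w)"
    using finV finite_non_nb by (intro card_mono) auto
  ultimately show False using C(2) by simp
qed

text \<open>The hub \<open>u\<close> has at least \<open>2 * n - 6\<close>
  \<open>H\<close>-neighbours, so eight remain besides the four in \<open>X\<close>. Each vertex of
  \<open>X\<close> has at most four \<open>F\<close>-neighbours, one of which is \<open>v\<close>
  outside \<open>Y\<close>; it misses at most three of the eight, as Jackson's condition
  requires.\<close>

lemma no_low_hub:
  assumes v: "v \<in> V" and W: "W \<subseteq> non_nb V v" "\<And>w. w \<in> W \<Longrightarrow> card (non_nb V w) \<le> 4"
    and u: "u \<in> W" "4 \<le> card (nb W u)"
  shows False
proof -
  have WV: "W \<subseteq> V" using W(1) by auto
  obtain X where X: "X \<subseteq> nb W u" "card X = 4" "finite X" using u(2) by (meson obtain_subset_with_card_n)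
  have "X \<subseteq> nb V u" using X(1) nb_mono[OF WV] by blast
  then have "card (nb V u - X) = card (nb V u) - 4" using X by (simp add: card_Diff_subset)
  moreover have "2 * n - 6 \<le> card (nb V u)"
    using card_nb_non_nb_in[OF finV, of u] W(2)[OF u(1)] u(1) WV cardV n by force
  ultimately have "8 \<le> card (nb V u - X)" using n by linarith
  then obtain Y where Y: "Y \<subseteq> nb V u - X" "card Y = 8" by (meson obtain_subset_with_card_n)
  have finY: "finite Y" using Y(2) by (auto intro: card_ge_0_finite)
  have vY: "v \<notin> Y" using Y(1) u(1) W(1) comm[of u v] by auto
  show False
  proof (rule no_Jackson[of u X Y])
    fix x assume "x \<in> X"
    then have x: "x \<in> W" using X(1) nb_subset by blast
    have "card (insert v (non_nb Y x)) \<le> card (non_nb V x)"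
      using finV v Y(1) W(1) x comm[of x v] by (intro card_mono finite_non_nb) auto
    moreover have "card (insert v (non_nb Y x)) = card (non_nb Y x) + 1"
      using vY finite_non_nb[OF finY] by simp
    ultimately show "2 * card (non_nb Y x) + 2 \<le> card Y" using W(2)[OF x] Y(2) by simp
  qed (use u WV X Y \<open>X \<subseteq> nb V u\<close> in auto)
qed

end

subsection \<open>The neighbourhood of a vertex of maximum degree\<close>

locale max_vertex = ramsey_counterexample +
  fixes v :: 'a
  assumes v: "v \<in> V" and max_v: "x \<in> V \<Longrightarrow> card (non_nb V x) \<le> card (non_nb V v)"
    and large_v: "n - 5 \<le> card (non_nb V v)"
begin

definition N where "N = non_nb V v"
definition B where "B = nb V v"

lemma finN: "finite N" and finB: "finite B" and NV: "N \<subseteq> V" and BV: "B \<subseteq> V"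
  and disj: "N \<inter> B = {}" "v \<notin> N" "v \<notin> B" and mem_V: "x \<in> V \<longleftrightarrow> x = v \<or> x \<in> N \<or> x \<in> B"
  using finV v irrefl by (auto simp: N_def B_def intro: finite_nb finite_non_nb)

lemma vB: "b \<in> B \<Longrightarrow> H v b" and vB': "b \<in> B \<Longrightarrow> H b v"
  using comm[of b v] by (auto simp: B_def)

lemma vN: "a \<in> N \<Longrightarrow> \<not> H v a" "a \<in> N \<Longrightarrow> \<not> H a v"
  using comm[of a v] by (auto simp: N_def)

lemma card_NB: "card N + card B + 2 = 2 * n"
  using card_nb_non_nb_in[OF finV v] cardV n unfolding N_def B_def by linarith

lemma card_non_nb_N:
  assumes "a \<in> N"
  shows "card (non_nb V a) = card (non_nb N a) + card (non_nb B a) + 1"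
proof -
  have "non_nb V a = insert v (non_nb (N \<union> B) a)"
    using assms vN disj v by (auto simp: mem_V)
  moreover have "v \<notin> non_nb (N \<union> B) a" using disj by auto
  moreover have "finite (non_nb (N \<union> B) a)" using finN finB by (intro finite_non_nb) auto
  ultimately show ?thesis using card_non_nb_Un[OF finN finB disj(1), of a] by simp
qed

text \<open>Maximality of \<open>v\<close> bounds the \<open>F\<close>-degree of \<open>b\<close> by
  \<open>card N\<close>, so every \<open>F\<close>-edge from \<open>b\<close> to \<open>N\<close>
  costs one inside \<open>B\<close> and forces another \<open>H\<close>-neighbour there.\<close>

lemma card_nb_B:
  assumes "b \<in> B"
  shows "card B + card (non_nb N b) \<le> card N + 1 + card (nb B b)"
proof -
  have "non_nb V b = non_nb (N \<union> B) b" using vB'[OF assms] disj by (auto simp: mem_V)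
  then have "card (non_nb V b) = card (non_nb N b) + card (non_nb B b)"
    using card_non_nb_Un[OF finN finB disj(1), of b] by simp
  moreover have "card (non_nb V b) \<le> card N" using max_v[of b] assms BV by (auto simp: N_def)
  ultimately show ?thesis using card_nb_non_nb_in[OF finB assms] by linarith
qed

lemma card_nb_N: "b \<in> B \<Longrightarrow> card (nb N b) + card (non_nb N b) = card N"
  using card_nb_non_nb_notin[OF finN, of b] disj by blast

text \<open>The first alternative means \<open>F\<close>-degree at most four, since \<open>v\<close>
  is a further \<open>F\<close>-neighbour of \<open>a\<close>. Otherwise \<open>no_tree\<close>
  applies to the edge \<open>va\<close>, with \<open>v\<close> as the larger centre:
  \<open>v\<close>, \<open>N\<close> and \<open>non_nb B a\<close> together have fewer than
  \<open>n\<close> vertices.\<close>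

lemma low_or_few:
  assumes a: "a \<in> N"
  shows "card (non_nb N a) + card (non_nb B a) \<le> 3 \<or> card N + 2 + card (non_nb B a) \<le> n"
proof (rule ccontr)
  assume "\<not> ?thesis"
  then have *: "4 \<le> card (non_nb N a) + card (non_nb B a)" "n < card N + 2 + card (non_nb B a)" by auto
  have av: "a \<in> V" "a \<noteq> v" "\<not> H a v" using a NV disj vN by auto
  have "card (non_nb V a \<union> non_nb V v) < n"
  proof (rule no_tree)
    show "n - 6 \<le> card (non_nb V v - {a})"
      using large_v a finN by (simp add: N_def[symmetric] card_Diff_singleton)
    have "v \<in> non_nb V a" using av v by auto
    then show "4 \<le> card (non_nb V a - {v})"
      using * card_non_nb_N[OF a] finV by (simp add: card_Diff_singleton finite_non_nb del: mem_non_nb)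
  qed (use av v in auto)
  moreover have "insert v (N \<union> non_nb B a) \<subseteq> non_nb V a \<union> non_nb V v"
    using av v BV by (auto simp: N_def)
  then have "card (insert v (N \<union> non_nb B a)) \<le> card (non_nb V a \<union> non_nb V v)"
    using finV finite_non_nb by (intro card_mono) auto
  moreover have "card (insert v (N \<union> non_nb B a)) = card N + card (non_nb B a) + 1"
  proof -
    have "v \<notin> N \<union> non_nb B a" "N \<inter> non_nb B a = {}" using disj by auto
    then show ?thesis using finN finite_non_nb[OF finB] by (simp add: card_Un_disjoint)
  qed
  ultimately show False using * by simp
qed

section \<open>Wheels with a hub in \<open>B\<close> or in \<open>N\<close>\<close>

lemma no_hub_cycle:
  assumes "b \<in> B" "{a1, a2, a3} \<subseteq> nb N b" "distinct [a1, a2, a3]"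
    and "{y0, y1, y2, y3} \<subseteq> nb B b" "distinct [y0, y1, y2, y3]"
    and "H a1 y0" "H a1 y1" "H a2 y1" "H a2 y2" "H a3 y2" "H a3 y3"
  shows False
proof -
  have "has_C8 H (nb V b)"
  \<comment> \<open>\<open>v\<close> is \<open>H\<close>-adjacent to the hub and to all of
    \<open>B\<close>, so it closes the path from \<open>y0\<close> to \<open>y3\<close>.\<close>
  proof (rule has_C8I[of v y0 a1 y1 a2 y2 a3 y3])
    have "{a1, a2, a3} \<inter> {y0, y1, y2, y3} = {}"
      using assms(2,4) disj nb_subset by blast
    moreover have "v \<notin> {a1, a2, a3}" "v \<notin> {y0, y1, y2, y3}" using assms(2,4) disj by auto
    ultimately show "distinct [v, y0, a1, y1, a2, y2, a3, y3]" using assms(3,5) by auto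
    show "{v, y0, a1, y1, a2, y2, a3, y3} \<subseteq> nb V b"
      using assms(1,2,4) NV BV v vB' by auto
    show "H v y0" "H y3 v" using assms(4) vB vB' by auto
    show "H y0 a1" "H y1 a2" "H y2 a3" using assms by (simp_all add: comm)
  qed (use assms in auto)
  then show False using no_wheel assms(1) BV by blast
qed

lemma no_hub_complete:
  assumes "b \<in> B" "X \<subseteq> nb N b" "3 \<le> card X" "Y \<subseteq> nb B b" "4 \<le> card Y"
    and complete: "\<And>x y. x \<in> X \<Longrightarrow> y \<in> Y \<Longrightarrow> H x y"
  shows False
proof -
  obtain a1 a2 a3 where a: "a1 \<in> X" "a2 \<in> X" "a3 \<in> X" "distinct [a1, a2, a3]"
    using ex_three[OF assms(3)] by blast
  obtain y0 y1 y2 y3 where y: "y0 \<in> Y" "y1 \<in> Y" "y2 \<in> Y" "y3 \<in> Y" "distinct [y0, y1, y2, y3]"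
    using ex_four[OF assms(5)] by blast
  show False
    by (rule no_hub_cycle[of b a1 a2 a3 y0 y1 y2 y3]) (use assms(1,2,4) a y complete in blast)+
qed

text \<open>Three \<open>H\<close>-neighbours of \<open>b\<close> in \<open>N\<close> each see all
  but \<open>r\<close> of \<open>?Y\<close>, hence at least four vertices, and any two share one. If
  two of them shared two vertices, distinct connecting vertices \<open>p\<close>, \<open>q\<close>
  would exist and the end vertices could be added, giving a cycle around \<open>b\<close>. With
  single overlaps the three neighbourhoods do not fit into \<open>?Y\<close>.\<close>

lemma few_in_N:
  assumes b: "b \<in> B" and r: "r \<le> 3" "r + 4 \<le> card (nb B b)"
    and miss: "\<And>a. a \<in> N \<Longrightarrow> card (non_nb B a) \<le> r"
  shows "card N \<le> card (non_nb N b) + 2"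
proof (rule ccontr)
  assume "\<not> ?thesis"
  then have "3 \<le> card (nb N b)" using card_nb_N[OF b] by linarith
  then obtain a1 a2 a3 where a: "a1 \<in> nb N b" "a2 \<in> nb N b" "a3 \<in> nb N b" "distinct [a1, a2, a3]"
    using ex_three by blast
  let ?Y = "nb B b"
  have finY: "finite ?Y" using finB by (rule finite_nb)
  have large: "card ?Y \<le> card (nb ?Y x) + r" if "x \<in> nb N b" for x
  proof -
    have "x \<notin> ?Y" "x \<in> N" using that disj by auto
    moreover have "card (non_nb ?Y x) \<le> card (non_nb B x)" using finB nb_subset by (rule non_nb_mono[rotated])
    ultimately show ?thesis using card_nb_non_nb_notin[OF finY] miss[of x] by fastforce
  qed
  have fin: "finite (nb ?Y x)" for x using finY by (rule finite_nb)
  have one: False if x: "x \<in> nb N b" "y \<in> nb N b" "z \<in> nb N b" "distinct [x, y, z]"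
    and p: "p \<in> nb ?Y x \<inter> nb ?Y y" "q \<in> nb ?Y y \<inter> nb ?Y z" "p \<noteq> q" for x y z p q
  proof -
    have 4: "4 \<le> card (nb ?Y x)" "4 \<le> card (nb ?Y z)" using large[OF x(1)] large[OF x(3)] r by linarith+
    have "card {p, q} < card (nb ?Y x)" using 4 p(3) by simp
    then obtain y0 where y0: "y0 \<in> nb ?Y x" "y0 \<notin> {p, q}" using card_ge_ex[OF fin] by blast
    have "card {p, q, y0} < card (nb ?Y z)" using 4(2) by (simp add: card_insert_if)
    then obtain y3 where y3: "y3 \<in> nb ?Y z" "y3 \<notin> {p, q, y0}" using card_ge_ex[OF fin] by blast
    show False
      by (rule no_hub_cycle[of b x y z y0 p q y3]) (use b x p y0 y3 in auto)
  qed
  have two: "card (nb ?Y x \<inter> nb ?Y y) \<ge> 1" if "x \<in> nb N b" "y \<in> nb N b" for x y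
    using card_Int_ge[OF finY nb_subset nb_subset, of x y] large[OF that(1)] large[OF that(2)] r by linarith
  have le1: "card (nb ?Y x \<inter> nb ?Y y) \<le> 1"
    if x: "x \<in> nb N b" "y \<in> nb N b" "z \<in> nb N b" "distinct [x, y, z]" for x y z
  proof (rule ccontr)
    assume "\<not> ?thesis"
    then have 2: "2 \<le> card (nb ?Y x \<inter> nb ?Y y)" by simp
    have "card (nb ?Y y \<inter> nb ?Y z) \<noteq> 0" using two[OF x(2,3)] by simp
    then have "nb ?Y y \<inter> nb ?Y z \<noteq> {}" by (metis card.empty)
    then obtain q where q: "q \<in> nb ?Y y \<inter> nb ?Y z" by blast
    have "card {q} < card (nb ?Y x \<inter> nb ?Y y)" using 2 by simp
    then obtain p where "p \<in> nb ?Y x \<inter> nb ?Y y" "p \<notin> {q}" using card_ge_ex[of _ "{q}"] fin by blast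
    with one[OF x _ q] show False by blast
  qed
  have "card (nb ?Y a1) + card (nb ?Y a2) + card (nb ?Y a3) \<le> card ?Y + 3"
  proof -
    have "card (nb ?Y a1 \<union> nb ?Y a2 \<union> nb ?Y a3) \<le> card ?Y"
      using finY nb_subset by (intro card_mono) blast+
    moreover have "card (nb ?Y a1 \<inter> nb ?Y a2) \<le> 1" "card (nb ?Y a2 \<inter> nb ?Y a3) \<le> 1"
      "card (nb ?Y a1 \<inter> nb ?Y a3) \<le> 1"
      using le1[of a1 a2 a3] le1[of a2 a3 a1] le1[of a1 a3 a2] a by auto
    ultimately show ?thesis
      using card_Un3_ge[OF fin fin fin, of a1 a2 a3] by linarith
  qed
  with large[OF a(1)] large[OF a(2)] large[OF a(3)] r show False by linarith
qed

lemma no_hub_in_N: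
  assumes a: "a \<in> N" "4 \<le> card (nb N a)" "8 \<le> card (nb B a)"
    and miss: "\<And>x. x \<in> N \<Longrightarrow> card (non_nb B x) \<le> 3"
  shows False
proof (rule no_Jackson[of a "nb N a" "nb B a"])
  fix x assume "x \<in> nb N a"
  then have "card (non_nb (nb B a) x) \<le> 3"
    using miss[of x] non_nb_mono[OF nb_subset finB, of a x] by fastforce
  with a(3) show "2 * card (non_nb (nb B a) x) + 2 \<le> card (nb B a)" by linarith
qed (use a NV BV disj nb_mono[of _ V a] in auto)

lemma no_low_set:
  assumes "W \<subseteq> N" "\<And>w. w \<in> W \<Longrightarrow> card (non_nb N w) + card (non_nb B w) \<le> 3" "u \<in> W"
  shows "card (nb W u) \<le> 3"
proof (rule ccontr)
  assume "\<not> ?thesis"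
  then have "4 \<le> card (nb W u)" by simp
  show False
  proof (rule no_low_hub[OF v _ _ assms(3) \<open>4 \<le> _\<close>])
    show "card (non_nb V w) \<le> 4" if "w \<in> W" for w
      using assms(1,2) that card_non_nb_N[of w] by force
  qed (use assms(1) in \<open>simp add: N_def\<close>)
qed

section \<open>Excluding each value of the maximum \<open>F\<close>-degree
  \<open>card N\<close>\<close>

lemma card_N_add_2_le: "card N + 2 \<le> n"
proof (rule ccontr)
  assume large: "\<not> ?thesis"
  \<comment> \<open>Only the first alternative of \<open>low_or_few\<close> is left, so
    \<open>no_low_set\<close> applies to all of \<open>N\<close>.\<close>
  then have low: "card (non_nb N a) + card (non_nb B a) \<le> 3" if "a \<in> N" for a
    using low_or_few[OF that] by linarith
  have "N \<noteq> {}" using large n by auto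
  then obtain u where u: "u \<in> N" by blast
  have "card (nb N u) \<le> 3" using no_low_set[OF order_refl low u] by blast
  with card_nb_non_nb_in[OF finN u] low[OF u] large n show False by linarith
qed

lemma sum_swap: "P \<subseteq> V \<Longrightarrow> Q \<subseteq> V \<Longrightarrow> (\<Sum>x\<in>P. card (non_nb Q x)) = (\<Sum>y\<in>Q. card (non_nb P y))"
  using finV finite_subset by (intro sum_non_nb_swap) auto

text \<open>Every vertex of \<open>B\<close> has seven \<open>H\<close>-neighbours in
  \<open>B\<close>, so it is \<open>F\<close>-adjacent to all but two vertices of \<open>N\<close>.
  That is too many edges, as each vertex of \<open>N\<close> sends at most three
  \<open>F\<close>-edges to \<open>B\<close>.\<close>

lemma card_N_add_5_ne: "card N + 5 \<noteq> n"
proof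
  assume N: "card N + 5 = n"
  have o: "card (non_nb B a) \<le> 3" if "a \<in> N" for a using low_or_few[OF that] N by linarith
  have f: "card N \<le> card (non_nb N b) + 2" if b: "b \<in> B" for b
  proof (rule few_in_N[OF b, of 3])
    show "3 + 4 \<le> card (nb B b)" using card_nb_B[OF b] card_NB N by linarith
  qed (use o in auto)
  have "card B * (card N - 2) \<le> (\<Sum>b\<in>B. card (non_nb N b))"
    using f sum_bounded_below[of B "card N - 2" "\<lambda>b. card (non_nb N b)"] by (simp add: le_diff_conv)
  also have "\<dots> = (\<Sum>a\<in>N. card (non_nb B a))" by (rule sum_swap[OF BV NV])
  also have "\<dots> \<le> card N * 3" using o sum_bounded_above[of N "\<lambda>a. card (non_nb B a)" 3] by simp
  finally have *: "card B * (card N - 2) \<le> card N * 3" .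
  obtain k where k: "n = k + 9" using n by (metis le_add_diff_inverse2)
  have "card N = k + 4" "card B = k + 12" using N card_NB k by auto
  with * show False by (simp add: algebra_simps)
qed


lemma no_sparse_subset:
  assumes "C \<subseteq> B" "n \<le> card C" "\<And>b. b \<in> C \<Longrightarrow> card (nb C b) \<le> 3"
  shows False
  by (rule no_sparse_set[OF v _ assms(2,3)]) (use assms(1) in \<open>simp add: B_def\<close>)

lemma NB: "a \<in> N \<Longrightarrow> a \<notin> B"
  using disj by blast

lemma card_nb_N_N: "a \<in> N \<Longrightarrow> card (nb N a) + card (non_nb N a) + 1 = card N"
  by (rule card_nb_non_nb_in[OF finN])

lemma card_nb_B_N: "a \<in> N \<Longrightarrow> card (nb B a) + card (non_nb B a) = card B"
  by (rule card_nb_non_nb_notin[OF finB NB])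

lemma all_nb: "finite S \<Longrightarrow> card (non_nb S y) = 0 \<Longrightarrow> x \<in> S \<Longrightarrow> x \<noteq> y \<Longrightarrow> H y x"
  using finite_non_nb by fastforce

text \<open>All of \<open>B\<close> is \<open>H\<close>-complete to \<open>N\<close> except for a
  set \<open>C\<close>, which has at most three vertices by double counting. Outside
  \<open>C\<close> the \<open>H\<close>-degrees are at most three. This settles
  \<open>card C \<le> 2\<close>; if \<open>C\<close> has three vertices, \<open>B - C\<close> is one
  vertex too small and a hub cycle is built directly.\<close>

lemma card_N_add_4_ne: "card N + 4 \<noteq> n"
proof
  assume N: "card N + 4 = n"
  have cB: "card B = n + 2" using card_NB N by linarith
  have o3: "card (non_nb B a) \<le> 3" if "a \<in> N" for a using low_or_few[OF that] N by linarith
  have o: "card (non_nb B a) \<le> 2" if a: "a \<in> N" for a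
  proof (rule ccontr)
    assume "\<not> ?thesis"
    then have "card (non_nb N a) = 0" "card (non_nb B a) = 3"
      using low_or_few[OF a] N by linarith+
    then have "4 \<le> card (nb N a)" "8 \<le> card (nb B a)"
      using card_nb_N_N[OF a] card_nb_B_N[OF a] N cB n by linarith+
    then show False using no_hub_in_N[OF a] o3 by blast
  qed
  have h: "5 + card (non_nb N b) \<le> card (nb B b)" if "b \<in> B" for b
    using card_nb_B[OF that] N cB by linarith
  \<comment> \<open>A single missed vertex of \<open>N\<close> raises the bound in \<open>h\<close>
    to six, as \<open>few_in_N\<close> demands for \<open>r = 2\<close>.\<close>
  have f: "card (non_nb N b) = 0 \<or> n - 6 \<le> card (non_nb N b)" if b: "b \<in> B" for b
  proof (rule disjCI)
    assume "\<not> n - 6 \<le> card (non_nb N b)"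
    then have "\<not> card N \<le> card (non_nb N b) + 2" using N n by linarith
    then show "card (non_nb N b) = 0"
      using few_in_N[OF b, of 2] h[OF b] o by fastforce
  qed
  have sum: "(\<Sum>b\<in>B. card (non_nb N b)) \<le> 2 * card N"
    using o sum_bounded_above[of N "\<lambda>a. card (non_nb B a)" 2] sum_swap[OF BV NV] by simp
  define C where "C = {b \<in> B. card (non_nb N b) \<noteq> 0}"
  have CB: "C \<subseteq> B" "finite C" using finB by (auto simp: C_def)
  have sumC: "(\<Sum>b\<in>C. card (non_nb N b)) \<le> 2 * card N"
    using sum sum_mono2[OF finB CB(1), of "\<lambda>b. card (non_nb N b)"] by simp
  have fC: "n - 6 \<le> card (non_nb N b)" if "b \<in> C" for b using f[of b] that by (auto simp: C_def)
  have "card C * (n - 6) \<le> 2 * card N"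
    using sumC sum_bounded_below[of C "n - 6" "\<lambda>b. card (non_nb N b)"] fC by simp
  have C3: "card C \<le> 3"
  proof (rule ccontr)
    assume "\<not> ?thesis"
    then have "4 * (n - 6) \<le> card C * (n - 6)" by (intro mult_right_mono) auto
    with \<open>card C * (n - 6) \<le> 2 * card N\<close> N n show False by linarith
  qed
  have free: "H x y" if "y \<in> B - C" "x \<in> N" for x y
    using all_nb[OF finN, of y x] that disj comm[of x y] by (auto simp: C_def)
  have deg: "card (nb (B - C) b) \<le> 3" if b: "b \<in> B - C" for b
  proof (rule ccontr)
    assume "\<not> ?thesis"
    then have 4: "4 \<le> card (nb (B - C) b)" by simp
    show False
      by (rule no_hub_complete[of b N "nb (B - C) b"])
         (use b free 4 N n nb_mono[of "B - C" B] free[OF b] comm[of b] in auto)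
  qed
  have cBC: "card (B - C) = n + 2 - card C" using CB cB by (simp add: card_Diff_subset)
  show False
  proof (cases "card C \<le> 2")
    case True
    then have "n \<le> card (B - C)" using cBC by linarith
    then show False using no_sparse_subset[of "B - C"] deg by blast
  next
    case False
    with C3 have C3: "card C = 3" by simp
    have "card (B - C) \<noteq> 0" using cBC C3 n by simp
    then obtain b where b: "b \<in> B - C" by (metis card.empty equals0I)
    have split: "card (nb B b) = card (nb (B - C) b) + card (nb C b)"
    proof -
      have "(B - C) \<union> C = B" using CB by blast
      then show ?thesis using card_nb_Un[of "B - C" C b] finB CB(2) by auto
    qed
    have "card (nb C b) \<le> card C" using CB(2) nb_subset by (rule card_mono)
    then have "2 \<le> card (nb (B - C) b)" using split h[of b] C3 b by auto
    then obtain y1 y2 where y12: "y1 \<in> nb (B - C) b" "y2 \<in> nb (B - C) b" "y1 \<noteq> y2"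
      using ex_two by blast
    \<comment> \<open>Two such vertices and the third one would send at least
      \<open>2 * (n - 5) + (n - 6)\<close> \<open>F\<close>-edges to \<open>N\<close>, more than
      \<open>2 * (n - 4)\<close>.\<close>
    have one: "c = c'" if c: "c \<in> C" "c' \<in> C" "card (nb N c) \<le> 1" "card (nb N c') \<le> 1" for c c'
    proof (rule ccontr)
      assume "c \<noteq> c'"
      then have "card (C - {c, c'}) \<noteq> 0" using C3 c CB(2) by simp
      then obtain d where d: "d \<in> C" "d \<noteq> c" "d \<noteq> c'" by (metis DiffD1 DiffD2 card.empty equals0I insertI1 insertI2)
      have "(\<Sum>b\<in>{c, c', d}. card (non_nb N b)) \<le> (\<Sum>b\<in>C. card (non_nb N b))"
        using CB(2) c d by (intro sum_mono2) auto
      then have "card (non_nb N c) + card (non_nb N c') + card (non_nb N d) \<le> 2 * card N"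
        using sumC \<open>c \<noteq> c'\<close> d by simp
      moreover have "card N \<le> card (non_nb N c) + 1" "card N \<le> card (non_nb N c') + 1"
        using card_nb_N[of c] card_nb_N[of c'] c CB(1) by auto
      ultimately show False using fC[OF d(1)] N n by linarith
    qed
    \<comment> \<open>The inner vertices \<open>y1\<close>, \<open>y2\<close> are complete to
      \<open>N\<close>. The end vertices \<open>y0\<close>, \<open>y3\<close> may lie in
      \<open>C\<close>; two \<open>H\<close>-neighbours in \<open>N\<close> each suffice to choose
      \<open>a1\<close>, \<open>a3\<close>, \<open>a2\<close> distinct, and \<open>P\<close> holds
      the unsuitable ones.\<close>
    define P where "P = {c \<in> nb B b. card (nb N c) \<le> 1}"
    have "P \<subseteq> C"
    proof
      fix c assume c: "c \<in> P"
      show "c \<in> C"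
      proof (rule ccontr)
        assume "c \<notin> C"
        then have "nb N c = N" using c free comm[of c] by (auto simp: P_def)
        with c N n show False by (simp add: P_def)
      qed
    qed
    then have P1: "card P \<le> 1"
      using one CB(2) by (auto simp: card_le_Suc0_iff_eq finite_subset P_def subset_iff)
    define G where "G = nb B b - P - {y1, y2}"
    have finP: "finite P" using finite_subset[OF \<open>P \<subseteq> C\<close> CB(2)] .
    have "card (nb B b) - card (P \<union> {y1, y2}) \<le> card (nb B b - (P \<union> {y1, y2}))"
      using finP by (intro diff_card_le_card_Diff) auto
    moreover have "card (P \<union> {y1, y2}) \<le> card P + card {y1, y2}" by (rule card_Un_le)
    moreover have "card {y1, y2} = 2" using y12 by simp
    moreover have "card (nb B b - (P \<union> {y1, y2})) = card G"
      unfolding G_def by (rule arg_cong[where f = card]) blast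
    ultimately have "card (nb B b) \<le> card G + card P + 2" by linarith
    then have "2 \<le> card G" using h[of b] b P1 by auto
    then obtain y0 y3 where y: "y0 \<in> G" "y3 \<in> G" "y0 \<noteq> y3"
      using ex_two by blast
    have "2 \<le> card (nb N y0)" "2 \<le> card (nb N y3)" "2 \<le> card N"
      using y N n by (auto simp: G_def P_def)
    moreover have "nb N y0 \<union> nb N y3 \<union> N = N" by auto
    ultimately obtain a1 a3 a2 where a: "a1 \<in> nb N y0" "a3 \<in> nb N y3" "a2 \<in> N" "distinct [a1, a3, a2]"
      using distinct_representatives_three[of "nb N y0" "nb N y3" N] N n by auto
    have "H b x" if "x \<in> N" for x using free[OF b that] comm by blast
    moreover have "H x y" if "x \<in> N" "y \<in> {y1, y2}" for x y using free that y12 by auto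
    moreover have "H a1 y0" "H a3 y3" using a comm by auto
    ultimately show False
      using no_hub_cycle[of b a1 a2 a3 y0 y1 y2 y3] a y y12 b by (auto simp: G_def)
  qed
qed

text \<open>For \<open>n = 9\<close> the counting bound of the general case is too weak by one.\<close>
lemma card_N_6_order_9:
  assumes N: "card N = 6" "n = 9" and a: "a \<in> N" "card (non_nb N a) = 0" "card (non_nb B a) = 3"
    and out: "\<And>x. x \<in> N \<Longrightarrow> card (non_nb B x) \<le> 1 \<or> card (non_nb N x) = 0 \<and> card (non_nb B x) = 3"
  shows False
proof -
  have cB: "card B = 10" using card_NB N by linarith
  define P where "P = {x \<in> N. card (non_nb B x) \<le> 1}"
  have PN: "P \<subseteq> N" and aP: "a \<notin> P" using a by (auto simp: P_def)
  have "x \<in> nb N a \<longleftrightarrow> x \<in> N - {a}" for x using all_nb[OF finN a(2), of x] irrefl[of a] by auto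
  then have nbN: "nb N a = N - {a}" by blast
  show False
  \<comment> \<open>With three vertices of \<open>P\<close> there is a cycle around the hub
    \<open>a\<close>: each sees six of the seven vertices of \<open>?Y\<close>, and any fourth
    vertex of \<open>N\<close> sees four.\<close>
  proof (cases "3 \<le> card P")
    case True
    then obtain p1 p2 p3 where p: "p1 \<in> P" "p2 \<in> P" "p3 \<in> P" "distinct [p1, p2, p3]" using ex_three by blast
    have "card {a, p1, p2, p3} < card N" using N(1) by (simp add: card_insert_if)
    then obtain w where w: "w \<in> N" "w \<notin> {a, p1, p2, p3}" using card_ge_ex[OF finN] by blast
    let ?Y = "nb B a"
    have finY: "finite ?Y" using finB by (rule finite_nb)
    have Y: "card ?Y = 7" using card_nb_B_N[OF a(1)] a(3) cB by simp
    have nbY: "7 \<le> card (nb ?Y x) + card (non_nb B x)" if "x \<in> N" for x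
    proof -
      have "x \<notin> ?Y" using NB[OF that] by auto
      then show ?thesis
        using card_nb_non_nb_notin[OF finY] non_nb_mono[OF nb_subset finB, of a x] Y by fastforce
    qed
    have P6: "6 \<le> card (nb ?Y x)" if "x \<in> P" for x using nbY[of x] that by (auto simp: P_def)
    have w4: "4 \<le> card (nb ?Y w)" using nbY[OF w(1)] out[OF w(1)] by linarith
    have I: "card (nb ?Y x) + card (nb ?Y y) \<le> 7 + card (nb ?Y x \<inter> nb ?Y y)" for x y
      using card_Int_ge[OF finY nb_subset nb_subset, of x y] Y by simp
    have "1 \<le> card (nb ?Y p3 \<inter> nb ?Y w)" "2 \<le> card (nb ?Y w \<inter> nb ?Y p1)"
      "3 \<le> card (nb ?Y p1 \<inter> nb ?Y p2)" "4 \<le> card (nb ?Y p2 \<inter> nb ?Y p3)"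
      using I[of p3 w] I[of w p1] I[of p1 p2] I[of p2 p3] P6[OF p(1)] P6[OF p(2)] P6[OF p(3)] w4
      by linarith+
    from distinct_representatives_greedy[OF this] obtain y3 y4 y1 y2 where y: "y3 \<in> nb ?Y p3 \<inter> nb ?Y w"
      "y4 \<in> nb ?Y w \<inter> nb ?Y p1" "y1 \<in> nb ?Y p1 \<inter> nb ?Y p2" "y2 \<in> nb ?Y p2 \<inter> nb ?Y p3"
      "distinct [y3, y4, y1, y2]" by blast
    have pN: "{p1, p2, p3, w} \<subseteq> nb N a" using p w PN aP unfolding nbN by auto
    have "has_C8 H (nb V a)"
    proof (rule C8_alternating[of p1 p2 p3 w _ ?Y])
      show "distinct [p1, p2, p3, w]" using p w by auto
      show "{p1, p2, p3, w} \<subseteq> nb V a" using pN nb_mono[OF NV] by blast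
      show "?Y \<subseteq> nb V a" by (rule nb_mono[OF BV])
      show "?Y \<inter> {p1, p2, p3, w} = {}" using pN disj nb_subset by blast
      have "distinct [y1, y2, y3, y4]" using y(5) by auto
      with y show "\<exists>y1 \<in> nb ?Y p1 \<inter> nb ?Y p2. \<exists>y2 \<in> nb ?Y p2 \<inter> nb ?Y p3. \<exists>y3 \<in> nb ?Y p3 \<inter> nb ?Y w.
        \<exists>y4 \<in> nb ?Y w \<inter> nb ?Y p1. distinct [y1, y2, y3, y4]" by blast
    qed
    with no_wheel a(1) NV show False by blast
  next
    case False
    have finP: "finite P" using finN PN finite_subset by blast
    have low: "card (non_nb N x) + card (non_nb B x) \<le> 3" if x: "x \<in> N" for x
    proof (cases "x \<in> P")
      case True
      \<comment> \<open>An \<open>F\<close>-neighbour of \<open>x\<close> in \<open>N\<close> has a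
        nonempty \<open>non_nb N\<close> itself, so \<open>out\<close> puts it into
        \<open>P\<close>. With \<open>P\<close> this small, all of \<open>N\<close> has
        \<open>F\<close>-degree at most four.\<close>
      have "non_nb N x \<subseteq> P - {x}"
      proof
        fix y assume y: "y \<in> non_nb N x"
        have "x \<in> non_nb N y" using y x comm by auto
        then have "card (non_nb N y) \<noteq> 0" using finite_non_nb[OF finN, of y] by auto
        then show "y \<in> P - {x}" using out[of y] y by (auto simp: P_def)
      qed
      then have "card (non_nb N x) \<le> card (P - {x})" using finP by (intro card_mono) auto
      then have "card (non_nb N x) \<le> 1" using finP True False by simp
      with True show ?thesis by (simp add: P_def)
    next
      case False
      then show ?thesis using out[OF x] x by (auto simp: P_def)
    qed
    have "card (nb N a) \<le> 3" by (rule no_low_set[OF order_refl low a(1)])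
    with nbN N(1) a(1) finN show False by simp
  qed
qed

text \<open>Each vertex of \<open>N\<close> sends at most one \<open>F\<close>-edge to
  \<open>B\<close>. Either one vertex \<open>c\<close> of \<open>B\<close> receives all but two of
  these edges, and deleting it leaves exactly \<open>n\<close> vertices, or the edges form a
  matching. In both cases four \<open>H\<close>-neighbours inside the remaining part of
  \<open>B\<close> would make a hub.\<close>

lemma card_N_add_3_ne: "card N + 3 \<noteq> n"
proof
  assume N: "card N + 3 = n"
  have cB: "card B = n + 1" using card_NB N by linarith
  have o3: "card (non_nb B a) \<le> 3" if "a \<in> N" for a using low_or_few[OF that] N by linarith
  have o: "card (non_nb B a) \<le> 1" if a: "a \<in> N" for a
  proof (rule ccontr)
    \<comment> \<open>By \<open>no_hub_in_N\<close> such an \<open>x\<close> has fewer than eight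
      \<open>H\<close>-neighbours among the \<open>n + 1\<close> vertices of \<open>B\<close> while
      missing at most three, which leaves only \<open>n = 9\<close>.\<close>
    have bad: "n = 9 \<and> card (non_nb N x) = 0 \<and> card (non_nb B x) = 3"
      if x: "x \<in> N" and c: "\<not> card (non_nb B x) \<le> 1" for x
    proof -
      have i: "card (non_nb N x) + card (non_nb B x) \<le> 3" using low_or_few[OF x] N c by linarith
      then have "4 \<le> card (nb N x)" using card_nb_N_N[OF x] N n c by linarith
      with no_hub_in_N[OF x _ _ o3] have "card (nb B x) < 8" by force
      then show ?thesis using card_nb_B_N[OF x] cB n i by linarith
    qed
    assume "\<not> ?thesis"
    then have 9: "n = 9" "card (non_nb N a) = 0" "card (non_nb B a) = 3" using bad[OF a] by auto
    show False
    proof (rule card_N_6_order_9[OF _ 9(1) a 9(2,3)])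
      show "card N = 6" using N 9(1) by linarith
      show "card (non_nb B x) \<le> 1 \<or> card (non_nb N x) = 0 \<and> card (non_nb B x) = 3" if "x \<in> N" for x
        using bad[OF that] by blast
    qed
  qed
  have h: "3 + card (non_nb N b) \<le> card (nb B b)" if "b \<in> B" for b
    using card_nb_B[OF that] N cB by linarith
  have f: "n \<le> card (non_nb N b) + 5" if "b \<in> B" "5 \<le> card (nb B b)" for b
    using few_in_N[of b 1] that o N by auto
  have sum: "(\<Sum>b\<in>B. card (non_nb N b)) \<le> card N"
    using o sum_bounded_above[of N "\<lambda>a. card (non_nb B a)" 1] sum_swap[OF BV NV] by simp
  show False
  proof (cases "\<exists>c\<in>B. 2 \<le> card (non_nb N c)")
    case True
    then obtain c where c: "c \<in> B" "2 \<le> card (non_nb N c)" by blast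
    then have fc: "n \<le> card (non_nb N c) + 5" using f[of c] h[of c] by linarith
    define B' where "B' = B - {c}"
    have B': "finite B'" "B' \<subseteq> B" "c \<notin> B'" "B = insert c B'" "card B' = n"
      using finB c cB by (auto simp: B'_def)
    have sum': "(\<Sum>b\<in>B'. card (non_nb N b)) \<le> 2"
      using sum fc N B'(1,3) unfolding B'(4) by simp
    show False
    proof (rule no_sparse_subset[OF B'(2)])
      show "n \<le> card B'" using B'(5) by simp
      fix b assume b: "b \<in> B'"
      show "card (nb B' b) \<le> 3"
      proof (rule ccontr)
        assume "\<not> ?thesis"
        then have 4: "4 \<le> card (nb B' b)" by simp
        define N0 where "N0 = {a \<in> N. card (non_nb B' a) = 0}"
        define N1 where "N1 = {a \<in> N. \<not> card (non_nb B' a) = 0}"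
        have "card N0 + card N1 = card N" unfolding N0_def N1_def by (rule card_split[OF finN])
        moreover have "card N1 \<le> 2"
        proof -
          have "card N1 = (\<Sum>a\<in>N1. 1)" by simp
          also have "\<dots> \<le> (\<Sum>a\<in>N1. card (non_nb B' a))"
            by (rule sum_mono) (auto simp: N1_def)
          also have "\<dots> \<le> (\<Sum>a\<in>N. card (non_nb B' a))"
            using finN by (intro sum_mono2) (auto simp: N1_def)
          also have "\<dots> = (\<Sum>b\<in>B'. card (non_nb N b))"
            using NV BV B'(2) by (intro sum_swap) auto
          finally show ?thesis using sum' by simp
        qed
        ultimately have "3 \<le> card N0" using N n by linarith
        have free: "H x y" if "x \<in> N0" "y \<in> B'" for x y
          using all_nb[OF B'(1), of x y] that NB B'(2) by (auto simp: N0_def)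
        show False
        proof (rule no_hub_complete[of b N0 "nb B' b"])
          show "N0 \<subseteq> nb N b"
          proof
            fix x assume "x \<in> N0"
            then show "x \<in> nb N b" using free[of x b] b comm by (auto simp: N0_def)
          qed
          show "nb B' b \<subseteq> nb B b" by (rule nb_mono[OF B'(2)])
        qed (use b B'(2) 4 \<open>3 \<le> card N0\<close> free in auto)
      qed
    qed
  next
    case False
    then have f1: "card (non_nb N b) \<le> 1" if "b \<in> B" for b using that by fastforce
    show False
    proof (rule no_sparse_subset[OF order_refl])
      show "n \<le> card B" using cB by simp
      fix b assume b: "b \<in> B"
      show "card (nb B b) \<le> 3"
      proof (rule ccontr)
        assume "\<not> ?thesis"
        then have "4 \<le> card (nb B b)" by simp
        then obtain Y where Y: "Y \<subseteq> nb B b" "card Y = 4" "finite Y" by (meson obtain_subset_with_card_n)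
        have YB: "Y \<subseteq> B" using Y(1) nb_subset by blast
        have Q: "5 \<le> card (nb N b)" using card_nb_N[OF b] f1[OF b] N n by linarith
        have "card (\<Union>y\<in>Y. non_nb N y) \<le> (\<Sum>y\<in>Y. card (non_nb N y))" by (rule card_UN_le[OF Y(3)])
        also have "\<dots> \<le> (\<Sum>y\<in>Y. 1)" by (rule sum_mono) (use f1 YB in auto)
        finally have "card (\<Union>y\<in>Y. non_nb N y) < card (nb N b)" using Y(2) Q by simp
        \<comment> \<open>The four vertices of \<open>Y\<close> have at most one
          \<open>F\<close>-neighbour in \<open>N\<close> each, and \<open>b\<close> has five
          \<open>H\<close>-neighbours there, so some \<open>a2\<close> is complete to
          \<open>Y\<close>.\<close>
        then obtain a2 where a2: "a2 \<in> nb N b" "a2 \<notin> (\<Union>y\<in>Y. non_nb N y)"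
          using card_ge_ex[OF finite_nb[OF finN]] Y(3) finite_non_nb[OF finN] by (meson finite_UN_I)
        have a2Y: "H a2 y" if "y \<in> Y" for y
        proof -
          have "a2 \<noteq> y" using a2(1) that NB YB nb_subset by blast
          with a2 that comm[of y a2] show ?thesis by auto
        qed
        have "2 \<le> card (nb N b - {a2})" using Q a2(1) finite_nb[OF finN, of b] by simp
        then obtain a1 a3 where a13: "a1 \<in> nb N b - {a2}" "a3 \<in> nb N b - {a2}" "a1 \<noteq> a3" using ex_two by blast
        have N3: "3 \<le> card (nb Y x)" if "x \<in> N" for x
        proof -
          have "x \<notin> Y" using NB[OF that] YB by blast
          then show ?thesis
            using card_nb_non_nb_notin[OF Y(3)] non_nb_mono[OF YB finB, of x] o[OF that] Y(2) by fastforce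
        qed
        \<comment> \<open>A vertex missed by both would have two \<open>F\<close>-neighbours in
          \<open>N\<close>. Taking each neighbourhood twice then satisfies Hall's condition and
          gives \<open>a1\<close> and \<open>a3\<close> two vertices of \<open>Y\<close>
          each.\<close>
        have "nb Y a1 \<union> nb Y a3 = Y"
        proof (intro equalityI subsetI)
          fix y assume y: "y \<in> Y"
          show "y \<in> nb Y a1 \<union> nb Y a3"
          proof (rule ccontr)
            assume c: "y \<notin> nb Y a1 \<union> nb Y a3"
            have "{a1, a3} \<subseteq> non_nb N y" using c y a13 NB YB comm by auto
            then have "card {a1, a3} \<le> card (non_nb N y)" using finite_non_nb[OF finN] by (intro card_mono)
            with f1[of y] y YB a13(3) show False by auto
          qed
        qed auto
        then have "\<exists>p\<in>nb Y a1. \<exists>q\<in>nb Y a1. \<exists>r\<in>nb Y a3. \<exists>s\<in>nb Y a3. distinct [p, q, r, s]"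
          using N3[of a1] N3[of a3] a13 Y(2) by (intro distinct_representatives_four) (auto simp: Un_absorb2[OF nb_subset] Un_commute)
        then obtain p q r s where "p \<in> nb Y a1" "q \<in> nb Y a1" "r \<in> nb Y a3" "s \<in> nb Y a3" "distinct [p, q, r, s]"
          by blast
        moreover from this have "{p, q, r, s} \<subseteq> nb B b" using Y(1) nb_subset by blast
        ultimately show False
          using no_hub_cycle[of b a1 a2 a3 p q r s] b a13 a2(1) a2Y by auto
      qed
    qed
  qed
qed

text \<open>By \<open>low_or_few\<close> each vertex of \<open>N\<close> has \<open>F\<close>-degree
  at most four or sends no \<open>F\<close>-edge to \<open>B\<close>. At most two are of the latter
  kind, since three would be complete to \<open>B\<close> and leave \<open>B\<close> sparse.
  Counting the \<open>F\<close>-edges between \<open>M\<close> and \<open>R\<close> from both sides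
  gives the contradiction.\<close>

lemma card_N_add_2_ne: "card N + 2 \<noteq> n"
proof
  assume N: "card N + 2 = n"
  have cB: "card B = n" using card_NB N by linarith
  define Z where "Z = {a \<in> N. card (non_nb B a) = 0}"
  define R where "R = {a \<in> N. \<not> card (non_nb B a) = 0}"
  define L where "L = {a \<in> N. card (non_nb N a) + card (non_nb B a) \<le> 3}"
  define M where "M = {a \<in> N. \<not> card (non_nb N a) + card (non_nb B a) \<le> 3}"
  have ZR: "card Z + card R = card N" unfolding Z_def R_def by (rule card_split[OF finN])
  have LM: "card L + card M = card N" unfolding L_def M_def by (rule card_split[OF finN])
  have fin: "finite Z" "finite R" "finite L" "finite M" using finN by (auto simp: Z_def R_def L_def M_def)
  have free: "H x y" if "x \<in> Z" "y \<in> B" for x y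
    using all_nb[OF finB, of x y] that NB by (auto simp: Z_def)
  have Z2: "card Z \<le> 2"
  proof (rule ccontr)
    assume "\<not> ?thesis"
    then have Z3: "3 \<le> card Z" by simp
    show False
    proof (rule no_sparse_subset[OF order_refl])
      fix b assume b: "b \<in> B"
      show "card (nb B b) \<le> 3"
      proof (rule ccontr)
        assume "\<not> ?thesis"
        then have 4: "4 \<le> card (nb B b)" by simp
        have ZN: "Z \<subseteq> nb N b"
        proof
          fix x assume "x \<in> Z"
          then show "x \<in> nb N b" using free[of x b] b comm by (auto simp: Z_def)
        qed
        show False by (rule no_hub_complete[OF b ZN Z3 order_refl 4]) (use free in auto)
      qed
    qed (simp add: cB)
  qed
  have MZ: "M \<subseteq> Z" using low_or_few N by (force simp: M_def Z_def)
  have RL: "R \<subseteq> L" using MZ by (auto simp: R_def L_def M_def Z_def)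
  have disjML: "L \<inter> M = {}" "N = L \<union> M" by (auto simp: L_def M_def)
  have cM: "card M \<le> card Z" using fin MZ by (intro card_mono)
  have Li: "card (nb L r) \<le> 3" if "r \<in> L" for r
    by (rule no_low_set[OF _ _ that]) (auto simp: L_def)
  \<comment> \<open>Of the at most three \<open>F\<close>-edges from \<open>r\<close> to
    \<open>N\<close> and \<open>B\<close>, one goes to \<open>B\<close>. By \<open>Li\<close> at
    least \<open>card L - 4\<close> go to \<open>L\<close>, so at most \<open>6 - card L\<close> go
    to \<open>M\<close>.\<close>
  have r: "card L \<le> card (non_nb L r) + 4 \<and> card (non_nb L r) + card (non_nb M r) \<le> 2" if r: "r \<in> R" for r
  proof -
    have "r \<in> L" using r RL by blast
    then have "card (nb L r) + card (non_nb L r) + 1 = card L" by (rule card_nb_non_nb_in[OF fin(3)])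
    moreover have "card (non_nb N r) = card (non_nb L r) + card (non_nb M r)"
      unfolding disjML(2) by (rule card_non_nb_Un[OF fin(3,4) disjML(1)])
    moreover have "card (non_nb N r) + card (non_nb B r) \<le> 3" "card (non_nb B r) \<noteq> 0"
      using \<open>r \<in> L\<close> r by (auto simp: L_def R_def)
    ultimately show ?thesis using Li[OF \<open>r \<in> L\<close>] by linarith
  qed
  have R5: "5 \<le> card R" using ZR Z2 N n by linarith
  then have "R \<noteq> {}" by auto
  then obtain r0 where "r0 \<in> R" by blast
  with r have L6: "card L \<le> 6" by fastforce
  \<comment> \<open>\<open>z\<close> has no \<open>F\<close>-edge to \<open>B\<close>, hence at
    least four inside \<open>N\<close>; at most one of these ends in \<open>Z\<close>.\<close>
  have z: "3 \<le> card (non_nb R z)" if z: "z \<in> M" for z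
  proof -
    have "z \<in> N" "z \<in> Z" using z MZ by (auto simp: M_def)
    have "4 \<le> card (non_nb N z)" using z \<open>z \<in> Z\<close> by (auto simp: M_def Z_def)
    moreover have "card (non_nb N z) = card (non_nb Z z) + card (non_nb R z)"
    proof -
      have "N = Z \<union> R" "Z \<inter> R = {}" by (auto simp: Z_def R_def)
      then show ?thesis using card_non_nb_Un[OF fin(1,2)] by simp
    qed
    moreover have "card (non_nb Z z) + 1 \<le> card Z"
      using card_nb_non_nb_in[OF fin(1) \<open>z \<in> Z\<close>] by linarith
    ultimately show ?thesis using Z2 by linarith
  qed
  have "card M * 3 \<le> (\<Sum>z\<in>M. card (non_nb R z))"
    using sum_bounded_below[of M 3 "\<lambda>z. card (non_nb R z)"] z by simp
  also have "\<dots> = (\<Sum>r\<in>R. card (non_nb M r))"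
    using NV by (intro sum_swap) (auto simp: M_def R_def)
  also have "\<dots> \<le> card R * (6 - card L)"
    using sum_bounded_above[of R "\<lambda>r. card (non_nb M r)" "6 - card L"] r by fastforce
  finally have *: "card M * 3 \<le> card R * (6 - card L)" .
  have "card R \<le> card L" using fin RL by (intro card_mono)
  have "1 \<le> card M" "7 \<le> card L + card M" using LM L6 N n by linarith+
  then have "card L = 6 \<or> card L = 5" using L6 cM Z2 by linarith
  then show False
  proof
    assume "card L = 6"
    with * \<open>1 \<le> card M\<close> show False by simp
  next
    assume "card L = 5"
    with * \<open>7 \<le> card L + card M\<close> \<open>card R \<le> card L\<close> show False by simp
  qed
qed

lemma no_max_vertex: False
  using card_N_add_2_le card_N_add_5_ne card_N_add_4_ne card_N_add_3_ne card_N_add_2_ne large_v n unfolding N_def[symmetric] by linarith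

end

context ramsey_counterexample
begin

lemma contradiction: False
proof -
  obtain w where w: "w \<in> V" "n - 5 \<le> card (non_nb V w)" using ex_large_non_degree by blast
  define f where "f x = card (non_nb V x)" for x
  have "f x \<le> card V" for x
    unfolding f_def using finV non_nb_subset by (rule card_mono)
  then have "\<exists>v. v \<in> V \<and> (\<forall>x. x \<in> V \<longrightarrow> f x \<le> f v)"
    using w(1) by (intro ex_has_greatest_nat[where b = "card V + 1"]) (auto simp: less_Suc_eq_le le_SucI)
  then obtain v where v: "v \<in> V" "\<And>x. x \<in> V \<Longrightarrow> card (non_nb V x) \<le> card (non_nb V v)"
    unfolding f_def by blast
  then have "n - 5 \<le> card (non_nb V v)" using w order_trans by blast
  with v interpret max_vertex H V n v by unfold_locales auto
  show False by (rule no_max_vertex)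
qed

end

subsection \<open>Embeddings and the lower bound\<close>

lemma contains_wheel8:
  assumes h: "h \<in> V" and C8: "has_C8 H {x \<in> V. H h x}"
    and H: "\<And>x y. H x y \<Longrightarrow> x \<noteq> y \<and> {x, y} \<notin> E"
  shows "contains_graph (complement (V, E)) (wheel 8)"
proof -
  obtain xs where xs: "length xs = 8" "distinct xs" "set xs \<subseteq> {x \<in> V. H h x}"
    "\<And>i. i < 8 \<Longrightarrow> H (xs ! i) (xs ! ((i + 1) mod 8))"
    using C8 unfolding has_C8_def by blast
  have x: "xs ! i \<in> V \<and> H h (xs ! i)" if "i < 8" for i
    using xs(1) that nth_mem[of i xs] subsetD[OF xs(3), of "xs ! i"] by simp
  define f where "f i = (if i < 8 then xs ! i else h)" for i :: nat
  have f8: "f 8 = h" by (simp add: f_def)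
  have edge: "{p, q} \<in> edges (complement (V, E))" if "p \<in> V" "q \<in> V" "H p q" for p q
    using that H[OF that(3)] by (auto simp: complement_def all_edges_def)
  have verts: "verts (wheel 8) = insert 8 {..<8}" by (simp add: wheel_def cycle_def)
  show ?thesis
    unfolding contains_graph_def
  proof (intro exI[of _ f] conjI ballI)
    have "h \<noteq> xs ! i" if "i < 8" for i using x[OF that] H by blast
    then have "h \<notin> f ` {..<8}" by (auto simp: f_def)
    moreover have "inj_on f {..<8}"
      using xs(1,2) by (auto simp: inj_on_def f_def nth_eq_iff_index_eq)
    ultimately show "inj_on f (verts (wheel 8))" unfolding verts by (simp add: f8)
    show "f ` verts (wheel 8) \<subseteq> verts (complement (V, E))"
      using x h by (auto simp: verts f_def complement_def)
    fix e assume "e \<in> edges (wheel 8)"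
    then consider i where "i < 8" "e = {i, (i + 1) mod 8}" | i where "i < 8" "e = {8, i}"
      by (auto simp: wheel_def cycle_def)
    then show "f ` e \<in> edges (complement (V, E))"
    proof cases
      case 1
      have "(i + 1) mod 8 < 8" by simp
      then have "f ` e = {xs ! i, xs ! ((i + 1) mod 8)}" using 1 by (simp add: f_def)
      with edge[OF _ _ xs(4)[OF 1(1)]] x[OF 1(1)] x[OF \<open>_ mod 8 < 8\<close>] show ?thesis by metis
    next
      case 2
      then have "f ` e = {h, xs ! i}" by (simp add: f_def)
      with edge[of h "xs ! i"] h x[OF 2(1)] show ?thesis by metis
    qed
  qed
qed

text \<open>Hall's condition for two sets with multiplicities. \<open>Q\<close> is taken from
  \<open>Y - X\<close> as far as possible, so that \<open>X\<close> loses as little as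
  possible.\<close>

lemma ex_disjoint_subsets:
  assumes "finite X" "finite Y" "p \<le> card X" "q \<le> card Y" "p + q \<le> card (X \<union> Y)"
  obtains P Q where "P \<subseteq> X" "Q \<subseteq> Y" "card P = p" "card Q = q" "P \<inter> Q = {}"
proof -
  have Q: "\<exists>Q\<subseteq>Y. card Q = q \<and> p \<le> card (X - Q)"
  proof (cases "q \<le> card (Y - X)")
    case True
    then obtain Q where "Q \<subseteq> Y - X" "card Q = q" by (meson obtain_subset_with_card_n)
    moreover from this have "X - Q = X" by blast
    ultimately show ?thesis using assms(3) by auto
  next
    case False
    have "card Y = card (Y \<inter> X) + card (Y - X)" using assms(2) by (rule card_Int_Diff)
    then have "q - card (Y - X) \<le> card (Y \<inter> X)" using assms(4) by simp
    then obtain R where R: "R \<subseteq> Y \<inter> X" "card R = q - card (Y - X)" by (meson obtain_subset_with_card_n)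
    then have finR: "finite R" using assms(2) by (meson finite_Int finite_subset)
    let ?Q = "(Y - X) \<union> R"
    have "card ?Q = q" using R False finR assms(2) by (subst card_Un_disjoint) auto
    moreover have "X - ?Q = (X \<union> Y) - ?Q" by blast
    moreover have "card ((X \<union> Y) - ?Q) = card (X \<union> Y) - card ?Q"
      using R(1) finR assms(2) by (intro card_Diff_subset) auto
    ultimately show ?thesis using R(1) assms(5) by (intro exI[of _ ?Q]) auto
  qed
  then obtain Q where Q: "Q \<subseteq> Y" "card Q = q" "p \<le> card (X - Q)" by blast
  then obtain P where "P \<subseteq> X - Q" "card P = p" by (meson obtain_subset_with_card_n)
  with Q that[of P Q] show thesis by blast
qed

lemma ex_star_embedding:
  assumes "finite P" "card P + 1 = k" "c \<notin> P"
  obtains g where "g 0 = c" "g ` {0<..<k} = P" "inj_on g {..<k}"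
proof -
  have "card {0<..<k} = card P" using assms(2) by simp
  then obtain g where g: "bij_betw g {0<..<k} P" using assms(1) by (meson finite_greaterThanLessThan finite_same_card_bij)
  let ?g = "g(0 := c)"
  have im: "?g ` {0<..<k} = P" using g by (auto simp: bij_betw_def)
  have "{..<k} = insert 0 {0<..<k}" using assms(2) by auto
  moreover have "inj_on ?g {0<..<k}" using g by (auto simp: bij_betw_def inj_on_def)
  ultimately have "inj_on ?g {..<k}" using im assms(3) by (auto simp: inj_on_insert)
  with im that[of ?g] show thesis by simp
qed

lemma contains_double_star:
  assumes "finite V" "u \<in> V" "v \<in> V" "{u, v} \<in> E" "u \<noteq> v" "0 < l" "l < n"
    and X: "X \<subseteq> V - {u, v}" "\<And>x. x \<in> X \<Longrightarrow> {v, x} \<in> E" "n - l - 1 \<le> card X"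
    and Y: "Y \<subseteq> V - {u, v}" "\<And>y. y \<in> Y \<Longrightarrow> {u, y} \<in> E" "l - 1 \<le> card Y"
    and XY: "n - 2 \<le> card (X \<union> Y)"
  shows "contains_graph (V, E) (double_star n l)"
proof -
  have fin: "finite X" "finite Y" using assms(1) X(1) Y(1) finite_subset by blast+
  obtain P Q where PQ: "P \<subseteq> X" "Q \<subseteq> Y" "card P = n - l - 1" "card Q = l - 1" "P \<inter> Q = {}"
    using ex_disjoint_subsets[OF fin X(3) Y(3)] XY assms(6,7) by force
  have finPQ: "finite P" "finite Q" using PQ fin finite_subset by blast+
  have notin: "u \<notin> Q" "v \<notin> P" using PQ X(1) Y(1) by blast+
  have "card Q + 1 = l" "card P + 1 = n - l" using PQ assms(6,7) by simp_all
  note star_emb = ex_star_embedding[OF finPQ(2) this(1) notin(1)] ex_star_embedding[OF finPQ(1) this(2) notin(2)]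
  obtain g where g: "g 0 = u" "g ` {0<..<l} = Q" "inj_on g {..<l}"
    using star_emb(1) by blast
  obtain h where h: "h 0 = v" "h ` {0<..<n - l} = P" "inj_on h {..<n - l}"
    using star_emb(2) by blast
  have split: "{..<k} = insert 0 {0<..<k}" if "0 < k" for k :: nat using that by auto
  have img: "g ` {..<l} = insert u Q" "h ` {..<n - l} = insert v P"
    using g h assms(6,7) by (simp_all add: split)
  have verts: "verts (double_star n l) = Inl ` {..<l} \<union> Inr ` {..<n - l}"
    by (simp add: double_star_def star_def)
  let ?f = "case_sum g h"
  show ?thesis
    unfolding contains_graph_def
  proof (intro exI[of _ ?f] conjI ballI)
    have "insert u Q \<inter> insert v P = {}" using PQ X(1) Y(1) assms(5) by blast
    then have "g i \<noteq> h j" if "i < l" "j < n - l" for i j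
      using img that by (metis IntI emptyE imageI lessThan_iff)
    then show "inj_on ?f (verts (double_star n l))"
      using g(3) h(3) unfolding verts by (fastforce simp: inj_on_def)
    have "insert u Q \<union> insert v P \<subseteq> V" using PQ X(1) Y(1) assms(2,3) by blast
    then show "?f ` verts (double_star n l) \<subseteq> verts (V, E)"
      using img unfolding verts by (auto simp: image_Un image_image)
    fix e assume "e \<in> edges (double_star n l)"
    then consider i where "0 < i" "i < l" "e = {Inl 0, Inl i}"
      | i where "0 < i" "i < n - l" "e = {Inr 0, Inr i}" | "e = {Inl 0, Inr 0}"
      by (auto simp: double_star_def star_def)
    then show "?f ` e \<in> edges (V, E)"
    proof cases
      case 1
      then have "g i \<in> Y" using g(2) PQ(2) by auto
      with 1 g(1) Y(2) show ?thesis by simp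
    next
      case 2
      then have "h i \<in> X" using h(2) PQ(1) by auto
      with 2 h(1) X(2) show ?thesis by simp
    next
      case 3
      with g(1) h(1) assms(4) show ?thesis by simp
    qed
  qed
qed

lemma ramsey_upper:
  fixes F :: "nat graph"
  assumes n: "n \<ge> 9" and F: "simple_graph F" "graph_order F = 2 * n - 1"
  shows "contains_graph F (double_star n 5) \<or> contains_graph (complement F) (wheel 8)"
proof (rule ccontr)
  assume no: "\<not> ?thesis"
  obtain V E where VE: "F = (V, E)" by fastforce
  have finV: "finite V" and cV: "card V = 2 * n - 1"
    using F by (auto simp: VE simple_graph_def graph_order_def)
  define H where "H x y \<longleftrightarrow> x \<noteq> y \<and> {x, y} \<notin> E" for x y
  interpret graph_rel H
    by unfold_locales (auto simp: H_def insert_commute)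
  have non: "y \<in> non_nb V x \<longleftrightarrow> y \<in> V \<and> y \<noteq> x \<and> {x, y} \<in> E" for x y
    by (auto simp: H_def)
  have H: "x \<noteq> y \<and> {x, y} \<notin> E" if "H x y" for x y using that by (simp add: H_def)
  interpret ramsey_counterexample H V n
  proof
    show "\<not> has_C8 H (nb V h)" if "h \<in> V" for h
      using contains_wheel8[OF that _ H] no unfolding VE nb_def by blast
    show "card (non_nb V u \<union> non_nb V v) < n"
      if "u \<in> V" "v \<in> V" "u \<noteq> v" "\<not> H u v" "n - 6 \<le> card (non_nb V v - {u})" "4 \<le> card (non_nb V u - {v})"
      for u v
    proof (rule ccontr)
      assume "\<not> ?thesis"
      then have big: "n \<le> card (non_nb V u \<union> non_nb V v)" by simp
      have "(non_nb V v - {u}) \<union> (non_nb V u - {v}) = (non_nb V u \<union> non_nb V v) - {u, v}"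
        by auto
      moreover have "card (non_nb V u \<union> non_nb V v) - card {u, v} \<le> card ((non_nb V u \<union> non_nb V v) - {u, v})"
        by (intro diff_card_le_card_Diff) auto
      ultimately have "n - 2 \<le> card ((non_nb V v - {u}) \<union> (non_nb V u - {v}))"
        using big \<open>u \<noteq> v\<close> by simp
      then have "contains_graph (V, E) (double_star n 5)"
      proof (intro contains_double_star[of V u v E 5 n "non_nb V v - {u}" "non_nb V u - {v}"])
        show "{u, v} \<in> E" using that by (auto simp: H_def)
        show "n - 5 - 1 \<le> card (non_nb V v - {u})" "5 - 1 \<le> card (non_nb V u - {v})" using that by simp_all
        show "non_nb V v - {u} \<subseteq> V - {u, v}" "non_nb V u - {v} \<subseteq> V - {u, v}" using non by blast+
        show "{v, x} \<in> E" if "x \<in> non_nb V v - {u}" for x using that non by blast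
        show "{u, y} \<in> E" if "y \<in> non_nb V u - {v}" for y using that non by blast
      qed (use that finV n in auto)
      with no VE show False by simp
    qed
  qed (use finV cV n in auto)
  show False by (rule contradiction)
qed

text \<open>\<open>F\<close> consists of at most two cliques of order at most \<open>n - 1\<close>.
  The tree is connected and too large for either; the complement is bipartite, whereas the wheel has
  the triangle \<open>0\<close>, \<open>1\<close>, \<open>m\<close>. Every smaller \<open>N\<close>
  is treated because a least element has to lie below each value with the Ramsey property.\<close>

lemma ramsey_lower:
  assumes "N < 2 * n - 1" "0 < l" "l < n" "m \<ge> 3"
  shows "\<exists>F :: nat graph. simple_graph F \<and> graph_order F = N \<and>
    \<not> contains_graph F (double_star n l) \<and> \<not> contains_graph (complement F) (wheel m)"
proof -
  define side where "side x \<longleftrightarrow> x < n - 1" for x :: nat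
  define E where "E = {e \<in> all_edges {..<N}. \<exists>x y. e = {x, y} \<and> (side x \<longleftrightarrow> side y)}"
  let ?F = "({..<N}, E)"
  have "simple_graph ?F" "graph_order ?F = N"
    by (auto simp: simple_graph_def E_def graph_order_def)
  moreover have "\<not> contains_graph ?F (double_star n l)"
  proof
    assume "contains_graph ?F (double_star n l)"
    then obtain f where f: "inj_on f (verts (double_star n l))" "f ` verts (double_star n l) \<subseteq> {..<N}"
      "\<And>e. e \<in> edges (double_star n l) \<Longrightarrow> f ` e \<in> E"
      unfolding contains_graph_def by auto
    have same: "side (f p) \<longleftrightarrow> side (f q)" if "{p, q} \<in> edges (double_star n l)" for p q
      using f(3)[OF that] by (auto simp: E_def doubleton_eq_iff)
    have centre: "side (f (Inl 0)) \<longleftrightarrow> side (f (Inr 0))"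
      by (rule same) (simp add: double_star_def)
    have all: "side (f p) \<longleftrightarrow> side (f (Inr 0))" if "p \<in> verts (double_star n l)" for p
    proof (cases p)
      case (Inl i)
      then have "i = 0 \<or> {Inl 0, p} \<in> edges (double_star n l)"
        using that by (auto simp: double_star_def star_def image_iff)
      then show ?thesis using same[of "Inl 0" p] centre Inl by auto
    next
      case (Inr i)
      then have "i = 0 \<or> {Inr 0, p} \<in> edges (double_star n l)"
        using that by (auto simp: double_star_def star_def image_iff)
      then show ?thesis using same[of "Inr 0" p] Inr by auto
    qed
    have "card (f ` verts (double_star n l)) \<le> n - 1"
    proof (cases "side (f (Inr 0))")
      case True
      then have "f ` verts (double_star n l) \<subseteq> {..<n - 1}" using all by (auto simp: side_def)
      from card_mono[OF _ this] show ?thesis by simp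
    next
      case False
      then have "f p \<in> {n - 1..<N}" if "p \<in> verts (double_star n l)" for p
        using all[OF that] f(2) that by (auto simp: side_def)
      then have "f ` verts (double_star n l) \<subseteq> {n - 1..<N}" by blast
      from card_mono[OF _ this] assms(1) show ?thesis by simp
    qed
    moreover have "card (f ` verts (double_star n l)) = n"
      using card_image[OF f(1)] graph_order_double_star[of l n] assms(3) by (simp add: graph_order_def)
    ultimately show False using assms(3) by simp
  qed
  moreover have "\<not> contains_graph (complement ?F) (wheel m)"
  proof
    assume "contains_graph (complement ?F) (wheel m)"
    then obtain f where f: "\<And>e. e \<in> edges (wheel m) \<Longrightarrow> f ` e \<in> edges (complement ?F)"
      unfolding contains_graph_def by auto
    have diff: "side (f p) \<noteq> side (f q)" if "{p, q} \<in> edges (wheel m)" for p q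
      using f[OF that] by (auto simp: complement_def E_def)
    have "{0, 1} \<in> edges (wheel m)"
      using assms(4) by (auto simp: wheel_def cycle_def intro!: exI[of _ 0])
    moreover have "{m, 0} \<in> edges (wheel m)" "{m, 1} \<in> edges (wheel m)"
      using assms(4) by (auto simp: wheel_def cycle_def)
    ultimately show False using diff[of 0 1] diff[of m 0] diff[of m 1] by blast
  qed
  ultimately show ?thesis by blast
qed

theorem theorem19:
  fixes n :: nat
  assumes "n \<ge> 9"
  shows "ramsey_number (double_star n 5) (wheel 8) = 2 * n - 1"
  unfolding ramsey_number_def
proof (rule Least_equality)
  show "\<forall>F :: nat graph. simple_graph F \<and> graph_order F = 2 * n - 1 \<longrightarrow>
      contains_graph F (double_star n 5) \<or> contains_graph (complement F) (wheel 8)"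
    using ramsey_upper[OF assms] by blast
  fix N
  assume all: "\<forall>F :: nat graph. simple_graph F \<and> graph_order F = N \<longrightarrow>
      contains_graph F (double_star n 5) \<or> contains_graph (complement F) (wheel 8)"
  show "2 * n - 1 \<le> N"
  proof (rule ccontr)
    assume "\<not> 2 * n - 1 \<le> N"
    with ramsey_lower[of N n 5 8] all assms show False by auto
  qed
qed

end
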